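(* Let $k\ge2$ be a fixed integer and let $\alpha>\beta>0$ be fixed constants. For even $n$ let $p=\frac{\alpha\log n}{\binom{n-1}{k-1}}$, $q=\frac{\beta\log n}{\binom{n-1}{k-1}}$, and let $(\sigma,\mathcal{H})\sim\mathsf{HSBM}(n,p,q;k)$. Define $$I_2(\alpha,\beta)=\max_{t\ge0}\frac{1}{2^{k-1}}\left(\alpha\left(1-e^{-(k-1)t}\right)+\beta\sum_{r=1}^{k-1}\binom{k-1}{r}\left(1-e^{-(k-1-2r)t}\right)\right).$$ If $I_2(\alpha,\beta)<1$, then $$\mathbb{P}\left(\widehat\sigma_{trunc}(\mathcal{H})\notin\{-\sigma,\sigma\}\right)=1-o(1).$$ In particular, the truncate-and-relax algorithm fails to recover $\sigma$ with probability $1-o(1)$, i.e. $\mathbb{P}\left(\widehat\Sigma(\mathcal{H})\ne\sigma\sigma^T\right)=1-o(1)$.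
   Context: Model: let $n$ be an even positive integer, $V=\{1,\dots,n\}$, $\binom{V}{k}$ the collection of $k$-element subsets of $V$, and $p,q\in[0,1]$. The model $\mathsf{HSBM}(n,p,q;k)$ samples a pair $(\sigma,\mathcal{H})$ as follows. First $\sigma\in\{\pm1\}^V$ is chosen uniformly at random among vectors with equally many $+1$'s and $-1$'s. Then, given $\sigma$, $\mathcal{H}$ is a random $k$-uniform hypergraph on $V$ in which each $e=\{e_1,\dots,e_k\}\in\binom{V}{k}$ is a hyperedge independently, with probability $p$ if $\sigma_{e_1}=\cdots=\sigma_{e_k}$ and with probability $q$ otherwise. Estimators: let $W$ be the symmetric $n\times n$ matrix with zero diagonal and, for $i\neq j$, $W_{ij}$ equal to the number of hyperedges of $\mathcal{H}$ containing both $i$ and $j$. Let $\mathbf{1}$ be the all-ones vector. Then $\widehat\sigma_{trunc}(\mathcal{H})$ is a maximizer of $\sum_{1\le i<j\le n}W_{ij}x_ix_j$ over $x\in\{\pm1\}^V$ with $\mathbf{1}^Tx=0$. The truncate-and-relax algorithm outputs $\widehat\Sigma(\mathcal{H})$, an optimal solution of the semidefinite program: maximize $\langle W,X\rangle$ over real symmetric $n\times n$ matrices $X\succeq0$ with $X_{ii}=1$ for all $i$ and $\langle X,\mathbf{1}\mathbf{1}^T\rangle=0$ (here $\langle A,B\rangle=\mathrm{tr}(A^TB)$). Asymptotics are as $n\to\infty$ along even integers with $k,\alpha,\beta$ fixed. *)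

theory Defs
  imports
    "HOL-Probability.Probability"
    "HOL-Library.Ramsey"
    "Jordan_Normal_Form.Matrix"
begin

hide_type (open) Finite_Cartesian_Product.vec
hide_const (open) Finite_Cartesian_Product.vec
no_notation Finite_Cartesian_Product.vec_nth (infixl "$" 90)
no_notation Inner_Product.real_inner_class.inner (infix "\<bullet>" 70)

text \<open>
  The vertices are numbered \<open>0, \<dots>, n - 1\<close>, to agree with the index range of
  \<^typ>\<open>real vec\<close> and \<^typ>\<open>real mat\<close>.
\<close>

definition sign_vec :: "nat \<Rightarrow> real vec set" where
  "sign_vec n = {x \<in> carrier_vec n. \<forall>i<n. x $ i = 1 \<or> x $ i = -1}"

definition balanced_sign_vec :: "nat \<Rightarrow> real vec set" where
  "balanced_sign_vec n =
     {x \<in> sign_vec n. card {i. i < n \<and> x $ i = 1} = card {i. i < n \<and> x $ i = -1}}"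

text \<open>
  \<^const>\<open>bernoulli_pmf\<close> truncates its parameter to \<open>[0, 1]\<close>, so the model is total in \<open>p\<close> and
  \<open>q\<close> and agrees with the intended one for \<open>p, q \<in> [0, 1]\<close>.
\<close>

definition HSBM :: "nat \<Rightarrow> real \<Rightarrow> real \<Rightarrow> nat \<Rightarrow> (real vec \<times> nat set set) pmf" where
  "HSBM n p q k =
     bind_pmf (pmf_of_set (balanced_sign_vec n)) (\<lambda>\<sigma>.
       map_pmf (\<lambda>f. (\<sigma>, {e \<in> nsets {..<n} k. f e}))
         (Pi_pmf (nsets {..<n} k) False
           (\<lambda>e. bernoulli_pmf (if \<forall>i\<in>e. \<forall>j\<in>e. \<sigma> $ i = \<sigma> $ j then p else q))))"

definition W_mat :: "nat \<Rightarrow> nat set set \<Rightarrow> real mat" where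
  "W_mat n H = mat n n (\<lambda>(i, j). if i = j then 0 else real (card {e \<in> H. i \<in> e \<and> j \<in> e}))"

definition ones_vec :: "nat \<Rightarrow> real vec" where
  "ones_vec n = vec n (\<lambda>_. 1)"

definition outer_prod :: "real vec \<Rightarrow> real vec \<Rightarrow> real mat" where
  "outer_prod x y = mat (dim_vec x) (dim_vec y) (\<lambda>(i, j). x $ i * y $ j)"

definition mat_trace :: "real mat \<Rightarrow> real" where
  "mat_trace A = (\<Sum>i<dim_row A. A $$ (i, i))"

definition mat_inner :: "real mat \<Rightarrow> real mat \<Rightarrow> real" where
  "mat_inner A B = mat_trace (transpose_mat A * B)"

definition psd_mat :: "nat \<Rightarrow> real mat \<Rightarrow> bool" where
  "psd_mat n X \<longleftrightarrow> X \<in> carrier_mat n n \<and> transpose_mat X = X \<and>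
     (\<forall>v \<in> carrier_vec n. 0 \<le> v \<bullet> (X *\<^sub>v v))"

text \<open>
  Maximizers need not be unique. An estimator is any function of \<open>n\<close> and the hypergraph that
  selects one of them.
\<close>

definition is_sigma_trunc :: "nat \<Rightarrow> nat set set \<Rightarrow> real vec \<Rightarrow> bool" where
  "is_sigma_trunc n H =
     is_arg_max (\<lambda>x. \<Sum>j<n. \<Sum>i<j. W_mat n H $$ (i, j) * x $ i * x $ j)
       (\<lambda>x. x \<in> sign_vec n \<and> ones_vec n \<bullet> x = 0)"

definition is_Sigma_relax :: "nat \<Rightarrow> nat set set \<Rightarrow> real mat \<Rightarrow> bool" where
  "is_Sigma_relax n H =
     is_arg_max (\<lambda>X. mat_inner (W_mat n H) X)
       (\<lambda>X. psd_mat n X \<and> (\<forall>i<n. X $$ (i, i) = 1) \<and>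
            mat_inner X (outer_prod (ones_vec n) (ones_vec n)) = 0)"

definition trunc_estimator :: "nat \<Rightarrow> (nat \<Rightarrow> nat set set \<Rightarrow> real vec) \<Rightarrow> bool" where
  "trunc_estimator k est \<longleftrightarrow>
     (\<forall>n H. even n \<longrightarrow> n > 0 \<longrightarrow> H \<subseteq> nsets {..<n} k \<longrightarrow> is_sigma_trunc n H (est n H))"

definition relax_estimator :: "nat \<Rightarrow> (nat \<Rightarrow> nat set set \<Rightarrow> real mat) \<Rightarrow> bool" where
  "relax_estimator k est \<longleftrightarrow>
     (\<forall>n H. even n \<longrightarrow> n > 0 \<longrightarrow> H \<subseteq> nsets {..<n} k \<longrightarrow> is_Sigma_relax n H (est n H))"

definition edge_prob :: "nat \<Rightarrow> nat \<Rightarrow> real \<Rightarrow> real" where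
  "edge_prob k n c = c * ln (real n) / real ((n - 1) choose (k - 1))"

definition I2_fun :: "nat \<Rightarrow> real \<Rightarrow> real \<Rightarrow> real \<Rightarrow> real" where
  "I2_fun k \<alpha> \<beta> t =
     1 / 2 ^ (k - 1) *
       (\<alpha> * (1 - exp (- (real k - 1) * t)) +
        \<beta> * (\<Sum>r = 1..k - 1. real ((k - 1) choose r) *
               (1 - exp (- (real k - 1 - 2 * real r) * t))))"

definition I2 :: "nat \<Rightarrow> real \<Rightarrow> real \<Rightarrow> real" where
  "I2 k \<alpha> \<beta> = (SUP t\<in>{0..}. I2_fun k \<alpha> \<beta> t)"

text \<open>The supremum is a maximum.\<close>

lemma I2_fun_bound:
  assumes k: "k \<ge> 2" and a: "\<alpha> > 0" and b: "\<beta> > 0" and t: "t \<ge> 0"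
  shows "I2_fun k \<alpha> \<beta> t \<le> (\<alpha> + \<beta> * 2 ^ (k - 1) - \<beta> * t) / 2 ^ (k - 1)"
proof -
  let ?m = "k - 1"
  have m: "?m \<ge> 1" "real k - 1 = real ?m" using k by auto
  have last: "1 - exp (- (real ?m - 2 * real ?m) * t) \<le> - t"
  proof -
    have "- (real ?m - 2 * real ?m) * t = real ?m * t" by (simp add: algebra_simps)
    moreover have "1 * t \<le> real ?m * t" using m t by (intro mult_right_mono) auto
    then have "1 - exp (real ?m * t) \<le> - t"
      using exp_ge_add_one_self[of "real ?m * t"] by linarith
    ultimately show ?thesis by (simp only:)
  qed
  have "(\<Sum>r = 1..?m. real (?m choose r) * (1 - exp (- (real ?m - 2 * real r) * t)))
      \<le> (\<Sum>r = 1..?m. real (?m choose r) - (if r = ?m then t else 0))"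
  proof (rule sum_mono)
    fix r assume "r \<in> {1..?m}"
    show "real (?m choose r) * (1 - exp (- (real ?m - 2 * real r) * t))
        \<le> real (?m choose r) - (if r = ?m then t else 0)"
    proof (cases "r = ?m")
      case True
      then show ?thesis using last t by simp
    next
      case False
      have "real (?m choose r) * (1 - exp (- (real ?m - 2 * real r) * t)) \<le> real (?m choose r) * 1"
        by (intro mult_left_mono) auto
      then show ?thesis using False by simp
    qed
  qed
  also have "\<dots> = (\<Sum>r = 1..?m. real (?m choose r)) - t"
    using m by (simp add: sum_subtractf)
  also have "\<dots> \<le> 2 ^ ?m - t"
  proof -
    have "(\<Sum>r = 1..?m. ?m choose r) \<le> (\<Sum>r\<le>?m. ?m choose r)"
      by (rule sum_mono2) auto
    also have "\<dots> = 2 ^ ?m" by (rule choose_row_sum)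
    finally have "real (\<Sum>r = 1..?m. ?m choose r) \<le> real (2 ^ ?m)" by (simp only: of_nat_le_iff)
    then show ?thesis by simp
  qed
  finally have "\<beta> * (\<Sum>r = 1..?m. real (?m choose r) * (1 - exp (- (real ?m - 2 * real r) * t)))
      \<le> \<beta> * (2 ^ ?m - t)" using b by (intro mult_left_mono) auto
  moreover have "\<alpha> * (1 - exp (- real ?m * t)) \<le> \<alpha> * 1"
    using a by (intro mult_left_mono) auto
  ultimately have "\<alpha> * (1 - exp (- real ?m * t)) + \<beta> * (\<Sum>r = 1..?m. real (?m choose r) *
      (1 - exp (- (real ?m - 2 * real r) * t))) \<le> \<alpha> + \<beta> * 2 ^ ?m - \<beta> * t"
    by (simp add: algebra_simps)
  then show ?thesis unfolding I2_fun_def m(2) by (simp add: divide_right_mono)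
qed

lemma I2_is_max:
  assumes k: "k \<ge> 2" and a: "\<alpha> > 0" and b: "\<beta> > 0"
  shows "\<exists>t\<ge>0. I2 k \<alpha> \<beta> = I2_fun k \<alpha> \<beta> t \<and> (\<forall>s\<ge>0. I2_fun k \<alpha> \<beta> s \<le> I2_fun k \<alpha> \<beta> t)"
proof -
  define T where "T = (\<alpha> + \<beta> * 2 ^ (k - 1)) / \<beta>"
  have T: "T \<ge> 0" using a b by (simp add: T_def)
  have "continuous_on {0..T} (I2_fun k \<alpha> \<beta>)"
    unfolding I2_fun_def by (intro continuous_intros)
  then obtain t where t: "t \<in> {0..T}" "\<forall>s\<in>{0..T}. I2_fun k \<alpha> \<beta> s \<le> I2_fun k \<alpha> \<beta> t"
    using continuous_attains_sup[of "{0..T}" "I2_fun k \<alpha> \<beta>"] T by auto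
  have 0: "I2_fun k \<alpha> \<beta> 0 = 0" by (simp add: I2_fun_def)
  have *: "I2_fun k \<alpha> \<beta> s \<le> I2_fun k \<alpha> \<beta> t" if s: "s \<ge> 0" for s
  proof (cases "s \<le> T")
    case True
    then show ?thesis using t s by auto
  next
    case False
    then have "\<alpha> + \<beta> * 2 ^ (k - 1) - \<beta> * s \<le> 0"
      using b by (simp add: T_def field_simps)
    then have "I2_fun k \<alpha> \<beta> s \<le> 0"
      using I2_fun_bound[OF k a b s] by (smt (verit) divide_nonpos_pos zero_less_power)
    then show ?thesis using t(2) T 0 by (metis atLeastAtMost_iff order.refl order.trans)
  qed
  have "I2 k \<alpha> \<beta> = I2_fun k \<alpha> \<beta> t"
    unfolding I2_def by (rule cSup_eq_maximum) (use t * in auto)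
  then show ?thesis using t * by auto
qed

end

theory Submission
  imports Defs "HOL-Real_Asymp.Real_Asymp"
begin

text \<open>
  Up to a factor and a constant, the objective at \<open>x\<close> is the sum over the hyperedges \<open>e\<close> of
  \<open>(\<Sum>l\<in>e. x\<^sub>l)\<^sup>2\<close>, and the relaxation has the same objective at \<open>x x\<^sup>T\<close>.
  So both estimators fail as soon as swapping the signs of some \<open>i\<close> and \<open>j\<close> on opposite sides
  increases this sum. If no hyperedge contains both, it changes by \<open>-4\<close> times the sum of the local
  fields at \<open>i\<close> and \<open>j\<close>, where the local field at \<open>i\<close> is the sum of \<open>k - 1 - 2 r\<close> over the hyperedges
  through \<open>i\<close>, \<open>r\<close> being the number of vertices of the hyperedge on the other side.

  The number of hyperedges of type \<open>r\<close> through \<open>i\<close> is binomial, asymptotically Poisson with mean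
  \<open>\<mu>\<^sub>r ln n\<close>. Prescribing it to be about \<open>\<mu>\<^sub>r exp (-(k - 1 - 2 r) t) ln n\<close> for every \<open>r\<close>, where
  \<open>t\<close> is the maximiser in the definition of \<open>I\<^sub>2\<close>, has probability \<open>n powr (-I\<^sub>2 - o(1))\<close>; as \<open>t\<close> is a
  critical point, the local field is then essentially zero, and rounding makes it negative. Since
  \<open>I\<^sub>2 < 1\<close>, trying \<open>n powr (1 - o(1))\<close> vertices on each side succeeds with high probability.
\<close>

section \<open>Events in product measures and in the model\<close>

text \<open>Cutting both events down to the supports makes them countable, as the product rule for
  pmfs requires.\<close>

lemma measure_pair_pmf_Times:
  "measure_pmf.prob (pair_pmf M N) (A \<times> B) = measure_pmf.prob M A * measure_pmf.prob N B"
proof -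
  have "measure_pmf.prob (pair_pmf M N) (A \<times> B) =
      measure_pmf.prob (pair_pmf M N) ((A \<times> B) \<inter> set_pmf (pair_pmf M N))"
    by (rule measure_Int_set_pmf[symmetric])
  also have "(A \<times> B) \<inter> set_pmf (pair_pmf M N) = (A \<inter> set_pmf M) \<times> (B \<inter> set_pmf N)"
    by auto
  also have "measure_pmf.prob (pair_pmf M N) \<dots> =
      measure_pmf.prob M (A \<inter> set_pmf M) * measure_pmf.prob N (B \<inter> set_pmf N)"
    by (rule measure_pmf_prob_product; rule countable_Int2; rule countable_set_pmf)
  finally show ?thesis by (simp add: measure_Int_set_pmf)
qed

text \<open>\<open>Pi_pmf\<close> over \<open>A\<close> is the image of the independent pair of its
  restrictions to \<open>B\<close> and \<open>A - B\<close>. \<open>P\<close> sees only the first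
  component and \<open>Q\<close> only the second, so their conjunction becomes a rectangle.\<close>

lemma prob_Pi_pmf_indep:
  assumes A: "finite A" "B \<subseteq> A"
    and P: "\<And>f g. (\<And>x. x \<in> B \<Longrightarrow> f x = g x) \<Longrightarrow> P f = P g"
    and Q: "\<And>f g. (\<And>x. x \<in> A - B \<Longrightarrow> f x = g x) \<Longrightarrow> Q f = Q g"
  shows "measure_pmf.prob (Pi_pmf A d p) {f. P f \<and> Q f} =
    measure_pmf.prob (Pi_pmf A d p) {f. P f} * measure_pmf.prob (Pi_pmf A d p) {f. Q f}"
proof -
  have fin: "finite B" "finite (A - B)" using A finite_subset by auto
  have AB: "A = B \<union> (A - B)" using A by auto
  have split: "Pi_pmf A d p = map_pmf (\<lambda>(f, g) x. if x \<in> B then f x else g x)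
      (pair_pmf (Pi_pmf B d p) (Pi_pmf (A - B) d p))"
    by (subst AB, rule Pi_pmf_union) (use fin in auto)
  have *: "measure_pmf.prob (Pi_pmf A d p) {f. P' f \<and> Q' f} =
      measure_pmf.prob (Pi_pmf B d p) {f. P' f} * measure_pmf.prob (Pi_pmf (A - B) d p) {f. Q' f}"
    if P': "\<And>f g. (\<And>x. x \<in> B \<Longrightarrow> f x = g x) \<Longrightarrow> P' f = P' g"
      and Q': "\<And>f g. (\<And>x. x \<in> A - B \<Longrightarrow> f x = g x) \<Longrightarrow> Q' f = Q' g" for P' Q' :: "_ \<Rightarrow> bool"
  proof -
    have 1: "P' (\<lambda>x. if x \<in> B then f x else g x) = P' f" for f g by (rule P') auto
    have 2: "Q' (\<lambda>x. if x \<in> B then f x else g x) = Q' g" for f g by (rule Q') auto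
    have "measure_pmf.prob (Pi_pmf A d p) {f. P' f \<and> Q' f} =
        measure_pmf.prob (pair_pmf (Pi_pmf B d p) (Pi_pmf (A - B) d p)) ({f. P' f} \<times> {f. Q' f})"
      unfolding split measure_map_pmf by (rule arg_cong2[where f = measure]) (auto simp: 1 2)
    also have "\<dots> = measure_pmf.prob (Pi_pmf B d p) {f. P' f} *
        measure_pmf.prob (Pi_pmf (A - B) d p) {f. Q' f}"
      by (rule measure_pair_pmf_Times)
    finally show ?thesis .
  qed
  have "measure_pmf.prob (Pi_pmf A d p) {f. P f \<and> Q f} =
      measure_pmf.prob (Pi_pmf B d p) {f. P f} * measure_pmf.prob (Pi_pmf (A - B) d p) {f. Q f}"
    by (rule *[OF P Q])
  \<comment> \<open>With the trivial event as partner, the same identity turns the two restricted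
    factors back into probabilities over all of \<open>A\<close>.\<close>
  moreover have "measure_pmf.prob (Pi_pmf A d p) {f. P f} = measure_pmf.prob (Pi_pmf B d p) {f. P f}"
    using *[of P "\<lambda>_. True", OF P refl] by simp
  moreover have "measure_pmf.prob (Pi_pmf A d p) {f. Q f} = measure_pmf.prob (Pi_pmf (A - B) d p) {f. Q f}"
    using *[of "\<lambda>_. True" Q, OF refl Q] by simp
  ultimately show ?thesis by simp
qed

text \<open>\<open>G i\<close> is decided inside its own block \<open>S i\<close>, while every
  \<open>B i\<close> is decided outside all blocks; the events \<open>B i\<close> may depend on each
  other arbitrarily. Peeling off one index at a time, the failure at \<open>i\<close> splits into
  "\<open>G i\<close> fails" and "\<open>G i\<close> holds but so does \<open>B i\<close>", and in
  both parts \<open>G i\<close> is independent of the other event involved.\<close>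

lemma prob_all_fail_le:
  fixes \<pi> b :: real
  assumes A: "finite A" and I: "finite I" and S: "\<And>i. i \<in> I \<Longrightarrow> S i \<subseteq> A" "disjoint_family_on S I"
    and G: "\<And>i f g. i \<in> I \<Longrightarrow> (\<And>x. x \<in> S i \<Longrightarrow> f x = g x) \<Longrightarrow> G i f = G i g"
    and B: "\<And>i f g. i \<in> I \<Longrightarrow> (\<And>x. x \<in> A - (\<Union>j\<in>I. S j) \<Longrightarrow> f x = g x) \<Longrightarrow> B i f = B i g"
    and \<pi>: "\<And>i. i \<in> I \<Longrightarrow> measure_pmf.prob (Pi_pmf A d p) {f. G i f} = \<pi>"
    and b: "\<And>i. i \<in> I \<Longrightarrow> measure_pmf.prob (Pi_pmf A d p) {f. B i f} \<le> b" and b0: "b \<ge> 0"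
  shows "measure_pmf.prob (Pi_pmf A d p) {f. \<forall>i\<in>I. \<not> G i f \<or> B i f} \<le> (1 - \<pi>) ^ card I + b"
proof -
  let ?Pr = "\<lambda>P. measure_pmf.prob (Pi_pmf A d p) {f. P f}"
  have "?Pr (\<lambda>f. \<forall>i\<in>J. \<not> G i f \<or> B i f) \<le> (1 - \<pi>) ^ card J + b" if "J \<subseteq> I" for J
    using finite_subset[OF that I] that
  proof (induction J rule: finite_induct)
    case empty
    then show ?case using b0 by simp
  next
    case (insert i J)
    let ?F = "\<lambda>f. \<forall>i\<in>J. \<not> G i f \<or> B i f"
    have i: "i \<in> I" "J \<subseteq> I" "i \<notin> J" using insert by auto
    have Gi: "G i f = G i g" if "\<And>x. x \<in> S i \<Longrightarrow> f x = g x" for f g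
      by (rule G[OF i(1) that])
    have Bi: "B j f = B j g" if "\<And>x. x \<in> A - S i \<Longrightarrow> f x = g x" "j \<in> I" for f g j
      by (rule B[OF that(2)], rule that(1)) (use i(1) in auto)
    \<comment> \<open>The blocks of \<open>J\<close> are disjoint from \<open>S i\<close> and the
      events \<open>B j\<close> avoid every block, so what happens at \<open>J\<close> ignores the
      coordinates in \<open>S i\<close>.\<close>
    have Fi: "?F f = ?F g" if *: "\<And>x. x \<in> A - S i \<Longrightarrow> f x = g x" for f g
    proof (rule ball_cong[OF refl])
      fix j assume j: "j \<in> J"
      have "S j \<inter> S i = {}" using disjoint_family_onD[OF S(2), of j i] j i by auto
      then have "x \<in> A - S i" if "x \<in> S j" for x using that S(1)[of j] j i(2) by auto
      then have "G j f = G j g" using j i(2) by (intro G *) auto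
      moreover have "B j f = B j g" using j i(2) by (intro Bi *) auto
      ultimately show "(\<not> G j f \<or> B j f) = (\<not> G j g \<or> B j g)" by simp
    qed
    have ind1: "?Pr (\<lambda>f. \<not> G i f \<and> ?F f) = ?Pr (\<lambda>f. \<not> G i f) * ?Pr ?F"
    proof (rule prob_Pi_pmf_indep[OF A S(1)[OF i(1)]])
      show "(\<not> G i f) = (\<not> G i g)" if "\<And>x. x \<in> S i \<Longrightarrow> f x = g x" for f g
        by (subst Gi[OF that]) auto
    qed (rule Fi)
    have ind2: "?Pr (\<lambda>f. G i f \<and> B i f) = ?Pr (G i) * ?Pr (B i)"
      by (rule prob_Pi_pmf_indep[OF A S(1)[OF i(1)] Gi Bi[OF _ i(1)]])
    have "{f. \<not> G i f} = UNIV - {f. G i f}" by auto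
    then have neg: "?Pr (\<lambda>f. \<not> G i f) = 1 - \<pi>"
      using \<pi>[OF i(1)] measure_pmf.prob_compl[of "{f. G i f}" "Pi_pmf A d p"] by simp
    have \<pi>01: "0 \<le> \<pi>" "\<pi> \<le> 1"
      using \<pi>[OF i(1)] measure_nonneg[of "Pi_pmf A d p" "{f. G i f}"]
        measure_pmf.prob_le_1[of "Pi_pmf A d p" "{f. G i f}"] by auto
    have "?Pr (\<lambda>f. \<forall>i\<in>insert i J. \<not> G i f \<or> B i f) \<le>
        measure_pmf.prob (Pi_pmf A d p) ({f. \<not> G i f \<and> ?F f} \<union> {f. G i f \<and> B i f})"
      by (rule measure_pmf.finite_measure_mono) auto
    also have "\<dots> \<le> ?Pr (\<lambda>f. \<not> G i f \<and> ?F f) + ?Pr (\<lambda>f. G i f \<and> B i f)"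
      by (rule measure_Un_le) auto
    also have "\<dots> = (1 - \<pi>) * ?Pr ?F + \<pi> * ?Pr (B i)"
      unfolding ind1 ind2 neg \<pi>[OF i(1)] ..
    \<comment> \<open>The recursion is a convex combination with \<open>b\<close> as a fixed point,
      so the error \<open>b\<close> is paid once and not once per index.\<close>
    also have "\<dots> \<le> (1 - \<pi>) * ((1 - \<pi>) ^ card J + b) + \<pi> * b"
      using \<pi>01 insert.IH[OF i(2)] b[OF i(1)] by (intro add_mono mult_left_mono) auto
    also have "\<dots> = (1 - \<pi>) ^ card (insert i J) + b"
      using insert by (simp add: algebra_simps)
    finally show ?case .
  qed
  from this[OF order.refl] show ?thesis .
qed

text \<open>Restricting the product measure to \<open>C\<close> changes coordinates outside
  \<open>C\<close> only, hence not the count; on \<open>C\<close> the trials are identically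
  distributed.\<close>

lemma prob_card_eq_binomial:
  assumes A: "finite A" "C \<subseteq> A" and c: "c \<in> {0..1}" "\<And>x. x \<in> C \<Longrightarrow> p x = bernoulli_pmf c"
  shows "measure_pmf.prob (Pi_pmf A d p) {f. card {x\<in>C. f x} = m} = pmf (binomial_pmf (card C) c) m"
proof -
  have C: "finite C" using A finite_subset by auto
  have "binomial_pmf (card C) c = map_pmf (\<lambda>f. card {x\<in>C. f x}) (Pi_pmf C d (\<lambda>_. bernoulli_pmf c))"
    using c C by (intro binomial_pmf_altdef') auto
  also have "Pi_pmf C d (\<lambda>_. bernoulli_pmf c) = Pi_pmf C d p"
    using c C by (intro Pi_pmf_cong) auto
  also have "\<dots> = map_pmf (\<lambda>f x. if x \<in> C then f x else d) (Pi_pmf A d p)"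
    by (rule Pi_pmf_subset[OF A])
  also have "map_pmf (\<lambda>f. card {x\<in>C. f x}) \<dots> = map_pmf (\<lambda>f. card {x\<in>C. f x}) (Pi_pmf A d p)"
    unfolding map_pmf_comp by (intro map_pmf_cong refl arg_cong[of _ _ card]) auto
  finally show ?thesis
    by (simp add: pmf_map vimage_def)
qed

lemma prob_cards_eq_prod_binomial:
  assumes A: "finite A" and R: "finite R" and C: "\<And>r. r \<in> R \<Longrightarrow> C r \<subseteq> A" "disjoint_family_on C R"
    and c: "\<And>r. r \<in> R \<Longrightarrow> c r \<in> {0..1}" "\<And>r x. r \<in> R \<Longrightarrow> x \<in> C r \<Longrightarrow> p x = bernoulli_pmf (c r)"
  shows "measure_pmf.prob (Pi_pmf A d p) {f. \<forall>r\<in>R. card {x\<in>C r. f x} = m r} =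
    (\<Prod>r\<in>R. pmf (binomial_pmf (card (C r)) (c r)) (m r))"
  using R C c
proof (induction R rule: finite_induct)
  case (insert r R)
  have dis: "C r \<inter> C s = {}" if "s \<in> R" for s
    using insert.prems(2) insert.hyps that by (auto simp: disjoint_family_on_def)
  have "measure_pmf.prob (Pi_pmf A d p) {f. card {x\<in>C r. f x} = m r \<and> (\<forall>s\<in>R. card {x\<in>C s. f x} = m s)} =
      measure_pmf.prob (Pi_pmf A d p) {f. card {x\<in>C r. f x} = m r} *
      measure_pmf.prob (Pi_pmf A d p) {f. \<forall>s\<in>R. card {x\<in>C s. f x} = m s}"
  proof (rule prob_Pi_pmf_indep[OF A insert.prems(1)])
    fix f g :: "'a \<Rightarrow> bool"
    assume "\<And>x. x \<in> C r \<Longrightarrow> f x = g x"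
    then have "{x\<in>C r. f x} = {x\<in>C r. g x}" by auto
    then show "(card {x\<in>C r. f x} = m r) = (card {x\<in>C r. g x} = m r)" by simp
  next
    fix f g :: "'a \<Rightarrow> bool"
    assume "\<And>x. x \<in> A - C r \<Longrightarrow> f x = g x"
    then have "{x\<in>C s. f x} = {x\<in>C s. g x}" if "s \<in> R" for s
      using dis[OF that] insert.prems(1)[of s] that by blast
    then show "(\<forall>s\<in>R. card {x\<in>C s. f x} = m s) = (\<forall>s\<in>R. card {x\<in>C s. g x} = m s)" by simp
  qed simp
  also have "measure_pmf.prob (Pi_pmf A d p) {f. \<forall>s\<in>R. card {x\<in>C s. f x} = m s} =
      (\<Prod>r\<in>R. pmf (binomial_pmf (card (C r)) (c r)) (m r))"
    using insert.prems by (intro insert.IH) (auto simp: disjoint_family_on_def)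
  also have "measure_pmf.prob (Pi_pmf A d p) {f. card {x\<in>C r. f x} = m r} =
      pmf (binomial_pmf (card (C r)) (c r)) (m r)"
    using insert.prems by (intro prob_card_eq_binomial A) auto
  finally show ?case using insert.hyps by simp
qed simp

lemma prob_Pi_pmf_bernoulli_ex_le:
  fixes c :: real
  assumes A: "finite A" and C: "C \<subseteq> A" and c: "\<And>x. x \<in> C \<Longrightarrow> p x \<in> {0..c}" "c \<le> 1"
  shows "measure_pmf.prob (Pi_pmf A d (\<lambda>x. bernoulli_pmf (p x))) {f. \<exists>x\<in>C. f x} \<le> real (card C) * c"
proof -
  let ?M = "Pi_pmf A d (\<lambda>x. bernoulli_pmf (p x))"
  have fC: "finite C" using A C finite_subset by auto
  have "{f. \<exists>x\<in>C. f x} = (\<Union>x\<in>C. {f. f x})" by auto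
  then have "measure_pmf.prob ?M {f. \<exists>x\<in>C. f x} \<le> (\<Sum>x\<in>C. measure_pmf.prob ?M {f. f x})"
    by (simp only:) (intro measure_pmf.finite_measure_subadditive_finite fC, simp)
  also have "\<dots> \<le> (\<Sum>x\<in>C. c)"
  proof (rule sum_mono)
    fix x assume x: "x \<in> C"
    have "measure_pmf.prob ?M {f. f x} = measure_pmf.prob (map_pmf (\<lambda>f. f x) ?M) {True}"
      by (simp add: vimage_def)
    also have "map_pmf (\<lambda>f. f x) ?M = bernoulli_pmf (p x)"
      using x C by (subst Pi_pmf_component[OF A]) auto
    also have "measure_pmf.prob (bernoulli_pmf (p x)) {True} = p x"
      using c(1)[OF x] c(2) by (simp add: measure_pmf_single)
    finally show "measure_pmf.prob ?M {f. f x} \<le> c" using c x by auto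
  qed
  finally show ?thesis by simp
qed

section \<open>Balanced sign vectors and averaging over them\<close>

lemma finite_balanced_sign_vec: "finite (balanced_sign_vec n)"
proof (rule finite_subset)
  show "balanced_sign_vec n \<subseteq> vec_of_list ` {xs. set xs \<subseteq> {1, -1} \<and> length xs = n}"
  proof
    fix x assume x: "x \<in> balanced_sign_vec n"
    then have "set (list_of_vec x) \<subseteq> {1, -1}" "length (list_of_vec x) = n"
      by (auto simp: balanced_sign_vec_def sign_vec_def set_list_of_vec vec_set_def)
    then show "x \<in> vec_of_list ` {xs. set xs \<subseteq> {1, -1} \<and> length xs = n}"
      by (intro image_eqI[of _ _ "list_of_vec x"]) (auto simp: vec_list)
  qed
qed (rule finite_imageI, rule finite_lists_length_eq, simp)

text \<open>\<open>pmf_of_set\<close> is the uniform distribution only on a nonempty finite set. For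
  even \<open>n\<close>, plus signs on the first half and minus signs on the second give a
  member.\<close>

lemma balanced_sign_vec_nonempty:
  assumes "even n"
  shows "balanced_sign_vec n \<noteq> {}"
proof -
  obtain h where n: "n = 2 * h" using assms by auto
  define x :: "real vec" where "x = vec n (\<lambda>i. if i < h then 1 else -1)"
  have x: "x $ i = (if i < h then 1 else -1)" if "i < n" for i
    using that by (simp add: x_def)
  have "{i. i < n \<and> x $ i = 1} = {..<h}"
  proof (intro Set.set_eqI iffI)
    fix i assume "i \<in> {i. i < n \<and> x $ i = 1}"
    then show "i \<in> {..<h}" using x[of i] by (cases "i < h") simp_all
  qed (use x n in simp)
  moreover have "{i. i < n \<and> x $ i = -1} = {h..<n}"
  proof (intro Set.set_eqI iffI)
    fix i assume "i \<in> {i. i < n \<and> x $ i = -1}"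
    then show "i \<in> {h..<n}" using x[of i] by (cases "i < h") simp_all
  qed (use x in simp)
  moreover have "x \<in> sign_vec n"
    using x by (simp add: sign_vec_def) (simp add: x_def)
  ultimately have "x \<in> balanced_sign_vec n"
    by (simp add: balanced_sign_vec_def n)
  then show ?thesis by blast
qed

text \<open>A failure bound that is uniform in \<open>\<sigma>\<close> survives averaging over
  \<open>\<sigma>\<close>. From here on \<open>\<sigma>\<close> can be fixed and only the hyperedges
  are random.\<close>

lemma prob_HSBM_ge:
  assumes n: "even n"
    and \<delta>: "\<And>\<sigma>. \<sigma> \<in> balanced_sign_vec n \<Longrightarrow> measure_pmf.prob (Pi_pmf (nsets {..<n} k) False
           (\<lambda>e. bernoulli_pmf (if \<forall>i\<in>e. \<forall>j\<in>e. \<sigma> $ i = \<sigma> $ j then p else q)))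
           {f. \<not> P \<sigma> {e \<in> nsets {..<n} k. f e}} \<le> \<delta>"
  shows "measure_pmf.prob (HSBM n p q k) {(\<sigma>, H). P \<sigma> H} \<ge> 1 - \<delta>"
proof -
  have set: "set_pmf (pmf_of_set (balanced_sign_vec n)) = balanced_sign_vec n"
    by (rule set_pmf_of_set[OF balanced_sign_vec_nonempty[OF n] finite_balanced_sign_vec])
  \<comment> \<open>One instance of the hypothesis already forces \<open>\<delta>\<close> to be
    nonnegative, which the passage to \<open>ennreal\<close> needs.\<close>
  obtain \<sigma> where "\<sigma> \<in> balanced_sign_vec n" using balanced_sign_vec_nonempty[OF n] by auto
  from \<delta>[OF this] have \<delta>0: "\<delta> \<ge> 0" by (meson measure_nonneg order.trans)
  let ?X = "{(\<sigma>, H). \<not> P \<sigma> H}"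
  have "emeasure (HSBM n p q k) ?X \<le> (\<integral>\<^sup>+\<sigma>. ennreal \<delta> \<partial>pmf_of_set (balanced_sign_vec n))"
    unfolding HSBM_def emeasure_bind_pmf
  proof (rule nn_integral_mono_AE, unfold AE_measure_pmf_iff set, intro ballI)
    fix \<sigma> assume \<sigma>: "\<sigma> \<in> balanced_sign_vec n"
    show "emeasure (measure_pmf (map_pmf (\<lambda>f. (\<sigma>, {e \<in> nsets {..<n} k. f e})) (Pi_pmf (nsets {..<n} k) False
           (\<lambda>e. bernoulli_pmf (if \<forall>i\<in>e. \<forall>j\<in>e. \<sigma> $ i = \<sigma> $ j then p else q))))) ?X \<le> ennreal \<delta>"
      using \<delta>[OF \<sigma>] \<delta>0 by (simp add: measure_pmf.emeasure_eq_measure vimage_def ennreal_leI)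
  qed
  also have "\<dots> = ennreal \<delta>" by simp
  finally have "measure_pmf.prob (HSBM n p q k) ?X \<le> \<delta>"
    using \<delta>0 by (simp add: measure_pmf.emeasure_eq_measure)
  moreover have "{(\<sigma>, H). P \<sigma> H} = UNIV - ?X" by auto
  ultimately show ?thesis
    using measure_pmf.prob_compl[of ?X "HSBM n p q k"] by simp
qed

section \<open>Swapping two vertices\<close>

lemma sum_sum_symmetric:
  fixes g :: "nat \<Rightarrow> nat \<Rightarrow> real"
  assumes "\<And>i j. g i j = g j i" "\<And>i. g i i = 0"
  shows "(\<Sum>i<n. \<Sum>j<n. g i j) = 2 * (\<Sum>j<n. \<Sum>i<j. g i j)"
proof (induction n)
  case (Suc n)
  have "(\<Sum>j<n. g n j) = (\<Sum>i<n. g i n)"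
    by (rule sum.cong) (simp_all add: assms(1))
  then show ?case using Suc by (simp add: sum.distrib assms(2))
qed simp

text \<open>Writing each entry of \<open>W_mat\<close> as a sum of indicators over \<open>H\<close>
  and exchanging sums, a hyperedge \<open>e\<close> contributes the sum of
  \<open>x $ i * x $ j\<close> over ordered pairs of distinct vertices of \<open>e\<close>. That is
  the full square minus its diagonal, which is \<open>k\<close> because the entries are
  signs.\<close>

lemma sum_W_mat_eq:
  fixes x :: "real vec"
  assumes H: "H \<subseteq> nsets {..<n} k" and x: "x \<in> sign_vec n"
  shows "(\<Sum>i<n. \<Sum>j<n. W_mat n H $$ (i, j) * x $ i * x $ j) =
    (\<Sum>e\<in>H. (\<Sum>l\<in>e. x $ l)\<^sup>2 - real k)"
proof -
  have finH: "finite H"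
    by (rule finite_subset[OF H]) (simp add: finite_imp_finite_nsets)
  let ?t = "\<lambda>e i j. if i \<noteq> j \<and> i \<in> e \<and> j \<in> e then x $ i * x $ j else 0"
  have W: "W_mat n H $$ (i, j) * x $ i * x $ j = (\<Sum>e\<in>H. ?t e i j)" if "i < n" "j < n" for i j
  proof -
    have "(\<Sum>e\<in>H. ?t e i j) = (\<Sum>e\<in>{e\<in>H. i \<noteq> j \<and> i \<in> e \<and> j \<in> e}. x $ i * x $ j)"
      by (rule sum.inter_filter[OF finH, symmetric])
    also have "\<dots> = W_mat n H $$ (i, j) * x $ i * x $ j"
      using that by (simp add: W_mat_def)
    finally show ?thesis ..
  qed
  have edge: "(\<Sum>i<n. \<Sum>j<n. ?t e i j) = (\<Sum>l\<in>e. x $ l)\<^sup>2 - real k" if e: "e \<in> H" for e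
  proof -
    have e': "e \<subseteq> {..<n}" "finite e" "card e = k"
      using subsetD[OF H e] by (simp_all add: nsets_def)
    have "(\<Sum>i<n. \<Sum>j<n. ?t e i j) = (\<Sum>i<n. if i \<in> e then \<Sum>j\<in>e. if i \<noteq> j then x $ i * x $ j else 0 else 0)"
    proof (rule sum.cong[OF refl])
      fix i
      have "(\<Sum>j<n. ?t e i j) = (\<Sum>j\<in>e. ?t e i j)"
        by (rule sum.mono_neutral_right) (use e' in simp_all)
      also have "\<dots> = (if i \<in> e then \<Sum>j\<in>e. if i \<noteq> j then x $ i * x $ j else 0 else 0)"
        by (cases "i \<in> e") (simp_all add: if_distrib cong: if_cong)
      finally show "(\<Sum>j<n. ?t e i j) = \<dots>" .
    qed
    also have "\<dots> = (\<Sum>i\<in>e. if i \<in> e then \<Sum>j\<in>e. if i \<noteq> j then x $ i * x $ j else 0 else 0)"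
      by (rule sum.mono_neutral_right) (use e' in simp_all)
    also have "\<dots> = (\<Sum>i\<in>e. (\<Sum>j\<in>e. x $ i * x $ j) - 1)"
    proof (rule sum.cong[OF refl])
      fix i assume i: "i \<in> e"
      have xi: "x $ i * x $ i = 1" using x i e'(1) by (auto simp: sign_vec_def)
      have "(\<Sum>j\<in>e. if i \<noteq> j then x $ i * x $ j else 0) =
          (\<Sum>j\<in>e. x $ i * x $ j - (if i = j then x $ i * x $ j else 0))"
        by (rule sum.cong) simp_all
      also have "\<dots> = (\<Sum>j\<in>e. x $ i * x $ j) - 1"
        using e'(2) i xi by (simp add: sum_subtractf)
      finally show "(if i \<in> e then \<Sum>j\<in>e. if i \<noteq> j then x $ i * x $ j else 0 else 0) = \<dots>"
        using i by simp
    qed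
    also have "\<dots> = (\<Sum>l\<in>e. x $ l)\<^sup>2 - real k"
      using e'(3) by (simp add: sum_subtractf power2_eq_square sum_product)
    finally show ?thesis .
  qed
  have "(\<Sum>i<n. \<Sum>j<n. W_mat n H $$ (i, j) * x $ i * x $ j) = (\<Sum>i<n. \<Sum>j<n. \<Sum>e\<in>H. ?t e i j)"
    by (intro sum.cong refl W) simp_all
  also have "\<dots> = (\<Sum>i<n. \<Sum>e\<in>H. \<Sum>j<n. ?t e i j)"
    by (rule sum.cong[OF refl], rule sum.swap)
  also have "\<dots> = (\<Sum>e\<in>H. \<Sum>i<n. \<Sum>j<n. ?t e i j)"
    by (rule sum.swap)
  also have "\<dots> = (\<Sum>e\<in>H. (\<Sum>l\<in>e. x $ l)\<^sup>2 - real k)"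
    by (rule sum.cong[OF refl edge])
  finally show ?thesis .
qed

lemma sum_less_W_mat_eq:
  fixes x :: "real vec"
  assumes H: "H \<subseteq> nsets {..<n} k" and x: "x \<in> sign_vec n"
  shows "(\<Sum>j<n. \<Sum>i<j. W_mat n H $$ (i, j) * x $ i * x $ j) =
    (\<Sum>e\<in>H. (\<Sum>l\<in>e. x $ l)\<^sup>2 - real k) / 2"
proof -
  \<comment> \<open>\<open>?g\<close> agrees with the matrix expression on valid indices, but is
    symmetric with zero diagonal for all naturals, as \<open>sum_sum_symmetric\<close>
    demands.\<close>
  let ?g = "\<lambda>i j. real (if i = j then 0 else card {e\<in>H. i \<in> e \<and> j \<in> e}) * x $ i * x $ j"
  have g: "W_mat n H $$ (i, j) * x $ i * x $ j = ?g i j" if "i < n" "j < n" for i j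
    using that by (simp add: W_mat_def)
  have "(\<Sum>e\<in>H. (\<Sum>l\<in>e. x $ l)\<^sup>2 - real k) = (\<Sum>i<n. \<Sum>j<n. ?g i j)"
    unfolding sum_W_mat_eq[OF H x, symmetric] by (intro sum.cong refl g) simp_all
  also have "\<dots> = 2 * (\<Sum>j<n. \<Sum>i<j. ?g i j)"
    by (rule sum_sum_symmetric) (simp_all add: conj_commute)
  also have "(\<Sum>j<n. \<Sum>i<j. ?g i j) = (\<Sum>j<n. \<Sum>i<j. W_mat n H $$ (i, j) * x $ i * x $ j)"
    by (intro sum.cong refl g[symmetric]) simp_all
  finally show ?thesis by simp
qed

lemma mat_inner_outer_prod:
  fixes x y :: "real vec"
  assumes "A \<in> carrier_mat n n" "x \<in> carrier_vec n" "y \<in> carrier_vec n"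
  shows "mat_inner A (outer_prod x y) = (\<Sum>i<n. \<Sum>j<n. A $$ (j, i) * x $ j * y $ i)"
  unfolding mat_inner_def mat_trace_def outer_prod_def
  using assms by (auto simp: scalar_prod_def lessThan_atLeast0 mult.assoc intro!: sum.cong)

lemma mat_inner_W_mat_outer_prod:
  fixes x :: "real vec"
  assumes H: "H \<subseteq> nsets {..<n} k" and x: "x \<in> sign_vec n"
  shows "mat_inner (W_mat n H) (outer_prod x x) = (\<Sum>e\<in>H. (\<Sum>l\<in>e. x $ l)\<^sup>2 - real k)"
proof -
  have "mat_inner (W_mat n H) (outer_prod x x) = (\<Sum>i<n. \<Sum>j<n. W_mat n H $$ (j, i) * x $ j * x $ i)"
    by (rule mat_inner_outer_prod) (use x in \<open>simp_all add: W_mat_def sign_vec_def\<close>)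
  also have "\<dots> = (\<Sum>j<n. \<Sum>i<n. W_mat n H $$ (j, i) * x $ j * x $ i)"
    by (rule sum.swap)
  finally show ?thesis using sum_W_mat_eq[OF H x] by simp
qed

lemma ones_vec_scalar_prod:
  fixes x :: "real vec"
  assumes "x \<in> carrier_vec n"
  shows "ones_vec n \<bullet> x = (\<Sum>i<n. x $ i)"
  using assms by (simp add: scalar_prod_def ones_vec_def lessThan_atLeast0)

text \<open>The quadratic form of \<open>outer_prod x x\<close> at \<open>v\<close> is the square of
  \<open>x \<bullet> v\<close>, and its pairing with the all-ones matrix is the square of the entry
  sum. Thus a better balanced sign vector also yields a better feasible matrix for the
  relaxation.\<close>

lemma outer_prod_feasible:
  fixes x :: "real vec"
  assumes x: "x \<in> sign_vec n" "ones_vec n \<bullet> x = 0"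
  shows "psd_mat n (outer_prod x x) \<and> (\<forall>i<n. outer_prod x x $$ (i, i) = 1) \<and>
    mat_inner (outer_prod x x) (outer_prod (ones_vec n) (ones_vec n)) = 0"
proof -
  have dim: "dim_vec x = n" using x by (auto simp: sign_vec_def)
  have xc: "x \<in> carrier_vec n" using x by (auto simp: sign_vec_def)
  have s: "(\<Sum>i<n. x $ i) = 0" using x(2) ones_vec_scalar_prod[OF xc] by simp
  have X: "outer_prod x x \<in> carrier_mat n n" by (simp add: outer_prod_def dim)
  have "0 \<le> v \<bullet> (outer_prod x x *\<^sub>v v)" if v: "v \<in> carrier_vec n" for v
  proof -
    have "outer_prod x x *\<^sub>v v = (x \<bullet> v) \<cdot>\<^sub>v x"
      using v dim by (intro eq_vecI)
        (auto simp: outer_prod_def scalar_prod_def sum_distrib_right sum_distrib_left mult_ac intro!: sum.cong)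
    then have "v \<bullet> (outer_prod x x *\<^sub>v v) = (x \<bullet> v) * (v \<bullet> x)"
      using v xc by simp
    also have "v \<bullet> x = x \<bullet> v" by (rule comm_scalar_prod[OF v xc])
    finally show ?thesis by simp
  qed
  moreover have "transpose_mat (outer_prod x x) = outer_prod x x"
    by (intro eq_matI) (auto simp: outer_prod_def)
  moreover have "outer_prod x x $$ (i, i) = 1" if "i < n" for i
    using that x dim by (auto simp: outer_prod_def sign_vec_def)
  moreover have "mat_inner (outer_prod x x) (outer_prod (ones_vec n) (ones_vec n)) = 0"
  proof -
    have "mat_inner (outer_prod x x) (outer_prod (ones_vec n) (ones_vec n)) =
        (\<Sum>i<n. \<Sum>j<n. outer_prod x x $$ (j, i) * ones_vec n $ j * ones_vec n $ i)"
      by (rule mat_inner_outer_prod[OF X]) (simp_all add: ones_vec_def)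
    also have "\<dots> = (\<Sum>i<n. \<Sum>j<n. x $ j * x $ i)"
      by (intro sum.cong refl) (simp_all add: ones_vec_def outer_prod_def dim)
    also have "\<dots> = (\<Sum>i<n. x $ i) * (\<Sum>i<n. x $ i)"
      by (simp add: sum_product mult.commute)
    finally show ?thesis using s by simp
  qed
  ultimately show ?thesis using X by (simp add: psd_mat_def)
qed

section \<open>Local fields and the effect of a swap\<close>

text \<open>The factor \<open>\<sigma> $ i\<close> makes the value independent of which side
  \<open>i\<close> is on; a negative value means that the hyperedges through \<open>i\<close> lean
  towards the opposite side.\<close>

definition local_field :: "nat set set \<Rightarrow> real vec \<Rightarrow> nat \<Rightarrow> real" where
  "local_field H \<sigma> i = (\<Sum>e\<in>{e\<in>H. i \<in> e}. \<sigma> $ i * (\<Sum>l\<in>e - {i}. \<sigma> $ l))"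

text \<open>Both entries are negated, which is a swap and keeps the balance when they have opposite
  signs.\<close>

definition swap_vec :: "nat \<Rightarrow> nat \<Rightarrow> real vec \<Rightarrow> real vec" where
  "swap_vec i j \<sigma> = vec (dim_vec \<sigma>) (\<lambda>l. if l = i \<or> l = j then - \<sigma> $ l else \<sigma> $ l)"

text \<open>By \<open>no\<close>, a hyperedge contains at most one of \<open>i\<close> and
  \<open>j\<close>. If it contains \<open>a\<close> and its other signs sum to \<open>s\<close>,
  flipping \<open>a\<close> replaces the square of \<open>\<sigma> $ a + s\<close> by that of
  \<open>s - \<sigma> $ a\<close>, a change of \<open>-4 * \<sigma> $ a * s\<close>. Hence the
  effects of the two flips add up.\<close>

lemma swap_vec_energy:
  assumes H: "H \<subseteq> nsets {..<n} k" and \<sigma>: "\<sigma> \<in> carrier_vec n"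
    and no: "\<forall>e\<in>H. \<not> (i \<in> e \<and> j \<in> e)"
  shows "(\<Sum>e\<in>H. (\<Sum>l\<in>e. swap_vec i j \<sigma> $ l)\<^sup>2 - real k) =
    (\<Sum>e\<in>H. (\<Sum>l\<in>e. \<sigma> $ l)\<^sup>2 - real k) - 4 * (local_field H \<sigma> i + local_field H \<sigma> j)"
proof -
  have finH: "finite H"
    by (rule finite_subset[OF H]) (simp add: finite_imp_finite_nsets)
  let ?y = "swap_vec i j \<sigma>"
  let ?d = "\<lambda>i e. if i \<in> e then \<sigma> $ i * (\<Sum>l\<in>e - {i}. \<sigma> $ l) else 0"
  have one: "(\<Sum>l\<in>e. ?y $ l)\<^sup>2 = (\<Sum>l\<in>e. \<sigma> $ l)\<^sup>2 - 4 * (\<sigma> $ a * (\<Sum>l\<in>e - {a}. \<sigma> $ l))"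
    if e: "e \<in> H" and a: "a \<in> e" "a = i \<or> a = j" for e a
  proof -
    have e': "e \<subseteq> {..<n}" "finite e"
      using subsetD[OF H e] by (simp_all add: nsets_def)
    have y: "?y $ l = (if l = i \<or> l = j then - \<sigma> $ l else \<sigma> $ l)" if "l \<in> e" for l
      using that e' \<sigma> by (auto simp: swap_vec_def)
    have "(\<Sum>l\<in>e - {a}. ?y $ l) = (\<Sum>l\<in>e - {a}. \<sigma> $ l)"
      by (rule sum.cong) (use y no[rule_format, OF e] a in auto)
    then have Y: "(\<Sum>l\<in>e. ?y $ l) = - \<sigma> $ a + (\<Sum>l\<in>e - {a}. \<sigma> $ l)"
      using sum.remove[OF e'(2) a(1), of "\<lambda>l. ?y $ l"] y[OF a(1)] a by auto
    have S: "(\<Sum>l\<in>e. \<sigma> $ l) = \<sigma> $ a + (\<Sum>l\<in>e - {a}. \<sigma> $ l)"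
      by (rule sum.remove[OF e'(2) a(1)])
    show ?thesis unfolding Y S by (simp add: power2_eq_square algebra_simps)
  qed
  have edge: "(\<Sum>l\<in>e. ?y $ l)\<^sup>2 - real k = ((\<Sum>l\<in>e. \<sigma> $ l)\<^sup>2 - real k) - 4 * (?d i e + ?d j e)" if e: "e \<in> H" for e
  proof (cases "i \<in> e \<or> j \<in> e")
    case True
    then consider "i \<in> e" "j \<notin> e" | "j \<in> e" "i \<notin> e" using no[rule_format, OF e] by auto
    then show ?thesis by cases (use one[OF e] in simp_all)
  next
    case False
    have e': "e \<subseteq> {..<n}"
      using subsetD[OF H e] by (simp_all add: nsets_def)
    have "(\<Sum>l\<in>e. ?y $ l) = (\<Sum>l\<in>e. \<sigma> $ l)"
      by (rule sum.cong) (use False e' \<sigma> in \<open>auto simp: swap_vec_def\<close>)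
    then show ?thesis using False by simp
  qed
  have "(\<Sum>e\<in>H. ?d a e) = local_field H \<sigma> a" for a
    unfolding local_field_def by (rule sum.inter_filter[OF finH, symmetric])
  then have "(\<Sum>e\<in>H. ((\<Sum>l\<in>e. \<sigma> $ l)\<^sup>2 - real k) - 4 * (?d i e + ?d j e)) =
      (\<Sum>e\<in>H. (\<Sum>l\<in>e. \<sigma> $ l)\<^sup>2 - real k) - 4 * (local_field H \<sigma> i + local_field H \<sigma> j)"
    by (simp only: sum_subtractf sum.distrib sum_distrib_left[symmetric])
  then show ?thesis using sum.cong[OF refl edge, of H "\<lambda>e. e"] by simp
qed

lemma sum_balanced_sign_vec:
  assumes "\<sigma> \<in> balanced_sign_vec n"
  shows "(\<Sum>l<n. \<sigma> $ l) = 0"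
proof -
  let ?P = "{i. i < n \<and> \<sigma> $ i = 1}" and ?N = "{i. i < n \<and> \<sigma> $ i = -1}"
  have U: "{..<n} = ?P \<union> ?N" using assms by (auto simp: balanced_sign_vec_def sign_vec_def)
  have "(\<Sum>l<n. \<sigma> $ l) = (\<Sum>l\<in>?P. \<sigma> $ l) + (\<Sum>l\<in>?N. \<sigma> $ l)"
    unfolding U by (rule sum.union_disjoint) auto
  also have "(\<Sum>l\<in>?P. \<sigma> $ l) = (\<Sum>l\<in>?P. 1)" by (rule sum.cong) auto
  also have "(\<Sum>l\<in>?N. \<sigma> $ l) = (\<Sum>l\<in>?N. - 1)" by (rule sum.cong) auto
  finally show ?thesis using assms by (simp add: balanced_sign_vec_def)
qed

lemma swap_vec_feasible:
  assumes \<sigma>: "\<sigma> \<in> balanced_sign_vec n" and ij: "i < n" "j < n" "\<sigma> $ i = 1" "\<sigma> $ j = -1"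
  shows "swap_vec i j \<sigma> \<in> sign_vec n" "ones_vec n \<bullet> swap_vec i j \<sigma> = 0"
proof -
  have \<sigma>c: "dim_vec \<sigma> = n" using \<sigma> by (auto simp: balanced_sign_vec_def sign_vec_def)
  have vals: "\<sigma> $ l = 1 \<or> \<sigma> $ l = -1" if "l < n" for l
    using \<sigma> that by (simp add: balanced_sign_vec_def sign_vec_def)
  have "swap_vec i j \<sigma> $ l = 1 \<or> swap_vec i j \<sigma> $ l = -1" if "l < n" for l
    using vals[OF that] that \<sigma>c by (auto simp: swap_vec_def)
  moreover have "swap_vec i j \<sigma> \<in> carrier_vec n"
    using \<sigma>c by (simp add: swap_vec_def)
  ultimately show *: "swap_vec i j \<sigma> \<in> sign_vec n"
    by (simp add: sign_vec_def)
  have "ones_vec n \<bullet> swap_vec i j \<sigma> = (\<Sum>l<n. swap_vec i j \<sigma> $ l)"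
    by (rule ones_vec_scalar_prod) (use * in \<open>simp add: sign_vec_def\<close>)
  also have "\<dots> = (\<Sum>l<n. \<sigma> $ l + ((if l = i then - 2 else 0) + (if l = j then 2 else 0)))"
    by (rule sum.cong) (use ij \<sigma>c in \<open>auto simp: swap_vec_def\<close>)
  also have "\<dots> = 0"
    using ij sum_balanced_sign_vec[OF \<sigma>] by (simp add: sum.distrib)
  finally show "ones_vec n \<bullet> swap_vec i j \<sigma> = 0" .
qed

text \<open>A sufficient certificate for the existence of a better balanced vector. It is the only
  interface between the optimisation side and the probabilistic side.\<close>

definition improvable :: "nat \<Rightarrow> nat set set \<Rightarrow> real vec \<Rightarrow> bool" where
  "improvable n H \<sigma> \<longleftrightarrow> (\<exists>i<n. \<exists>j<n. \<sigma> $ i = 1 \<and> \<sigma> $ j = -1 \<and>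
     (\<forall>e\<in>H. \<not> (i \<in> e \<and> j \<in> e)) \<and> local_field H \<sigma> i + local_field H \<sigma> j < 0)"

text \<open>The swapped vector is feasible and has larger energy than \<open>\<sigma>\<close>;
  \<open>- \<sigma>\<close> has the energy of \<open>\<sigma>\<close> because energies are built
  from squares. The truncated objective is half of the energy and the relaxed objective at an outer
  product is the energy itself, so all three candidates are beaten by the same competitor.\<close>

lemma not_optimal:
  assumes H: "H \<subseteq> nsets {..<n} k" and \<sigma>: "\<sigma> \<in> balanced_sign_vec n"
    and imp: "improvable n H \<sigma>"
  shows "\<not> is_sigma_trunc n H \<sigma>" "\<not> is_sigma_trunc n H (- \<sigma>)"
    "\<not> is_Sigma_relax n H (outer_prod \<sigma> \<sigma>)"
proof -
  obtain i j where ij: "i < n" "j < n" "\<sigma> $ i = 1" "\<sigma> $ j = -1"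
    and no: "\<forall>e\<in>H. \<not> (i \<in> e \<and> j \<in> e)"
    and neg: "local_field H \<sigma> i + local_field H \<sigma> j < 0"
    using imp unfolding improvable_def by blast
  let ?E = "\<lambda>x :: real vec. \<Sum>e\<in>H. (\<Sum>l\<in>e. x $ l)\<^sup>2 - real k"
  have \<sigma>s: "\<sigma> \<in> sign_vec n" and \<sigma>c: "\<sigma> \<in> carrier_vec n"
    using \<sigma> by (simp_all add: balanced_sign_vec_def sign_vec_def)
  define y where "y = swap_vec i j \<sigma>"
  have y: "y \<in> sign_vec n" "ones_vec n \<bullet> y = 0"
    unfolding y_def by (rule swap_vec_feasible[OF \<sigma> ij])+
  have less: "?E y > ?E \<sigma>"
    using swap_vec_energy[OF H \<sigma>c no] neg by (simp add: y_def)
  have ms: "- \<sigma> \<in> sign_vec n"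
    using \<sigma>s by (auto simp: sign_vec_def)
  have "?E (- \<sigma>) = ?E \<sigma>"
  proof (rule sum.cong[OF refl])
    fix e assume "e \<in> H"
    then have "e \<subseteq> {..<n}" using H by (auto simp: nsets_def)
    then have "(\<Sum>l\<in>e. (- \<sigma>) $ l) = (\<Sum>l\<in>e. - \<sigma> $ l)"
      using \<sigma>c by (intro sum.cong) auto
    also have "\<dots> = - (\<Sum>l\<in>e. \<sigma> $ l)" by (rule sum_negf)
    finally show "(\<Sum>l\<in>e. (- \<sigma>) $ l)\<^sup>2 - real k = (\<Sum>l\<in>e. \<sigma> $ l)\<^sup>2 - real k" by simp
  qed
  then have less': "?E y > ?E (- \<sigma>)" using less by simp
  show "\<not> is_sigma_trunc n H \<sigma>"
    using less y \<sigma>s unfolding is_sigma_trunc_def is_arg_max_def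
    by (auto simp: sum_less_W_mat_eq[OF H])
  show "\<not> is_sigma_trunc n H (- \<sigma>)"
    using less' y ms unfolding is_sigma_trunc_def is_arg_max_def
    by (auto simp: sum_less_W_mat_eq[OF H])
  show "\<not> is_Sigma_relax n H (outer_prod \<sigma> \<sigma>)"
  proof
    assume "is_Sigma_relax n H (outer_prod \<sigma> \<sigma>)"
    then have "\<not> mat_inner (W_mat n H) (outer_prod \<sigma> \<sigma>) < mat_inner (W_mat n H) (outer_prod y y)"
      using outer_prod_feasible[OF y] unfolding is_Sigma_relax_def is_arg_max_def by blast
    then show False
      unfolding mat_inner_W_mat_outer_prod[OF H \<sigma>s] mat_inner_W_mat_outer_prod[OF H y(1)] using less by simp
  qed
qed

section \<open>Hyperedges by type around a small test set\<close>

text \<open>\<open>A\<close> is the test set. Requiring \<open>e \<inter> A = {i}\<close> makes the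
  classes of different tested vertices disjoint, so that their counts are independent.\<close>

definition local_class :: "nat \<Rightarrow> nat \<Rightarrow> real vec \<Rightarrow> nat set \<Rightarrow> nat \<Rightarrow> nat \<Rightarrow> nat set set" where
  "local_class n k \<sigma> A i r =
     {e \<in> nsets {..<n} k. e \<inter> A = {i} \<and> card {l\<in>e. \<sigma> $ l \<noteq> \<sigma> $ i} = r}"

lemma sign_sum_eq:
  assumes \<sigma>: "\<sigma> \<in> sign_vec n" and e: "e \<in> nsets {..<n} k" "i \<in> e"
  shows "\<sigma> $ i * (\<Sum>l\<in>e - {i}. \<sigma> $ l) = real k - 1 - 2 * real (card {l\<in>e. \<sigma> $ l \<noteq> \<sigma> $ i})"
proof -
  have e': "e \<subseteq> {..<n}" "finite e" "card e = k" using e by (auto simp: nsets_def)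
  have i: "\<sigma> $ i = 1 \<or> \<sigma> $ i = -1" using \<sigma> e' e(2) by (auto simp: sign_vec_def)
  have "\<sigma> $ i * (\<Sum>l\<in>e - {i}. \<sigma> $ l) = (\<Sum>l\<in>e - {i}. \<sigma> $ i * \<sigma> $ l)"
    by (rule sum_distrib_left)
  also have "\<dots> = (\<Sum>l\<in>e - {i}. 1 - (if \<sigma> $ l \<noteq> \<sigma> $ i then 2 else 0))"
  proof (rule sum.cong[OF refl])
    fix l assume "l \<in> e - {i}"
    then have "\<sigma> $ l = 1 \<or> \<sigma> $ l = -1" using \<sigma> e' by (auto simp: sign_vec_def)
    then show "\<sigma> $ i * \<sigma> $ l = 1 - (if \<sigma> $ l \<noteq> \<sigma> $ i then 2 else 0)" using i by auto
  qed
  also have "\<dots> = real (card (e - {i})) - (\<Sum>l\<in>e - {i}. if \<sigma> $ l \<noteq> \<sigma> $ i then 2 else 0)"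
    by (simp add: sum_subtractf)
  also have "(\<Sum>l\<in>e - {i}. if \<sigma> $ l \<noteq> \<sigma> $ i then 2 else (0::real)) =
      (\<Sum>l\<in>{l\<in>e - {i}. \<sigma> $ l \<noteq> \<sigma> $ i}. 2)"
    by (rule sum.inter_filter[symmetric]) (use e' in simp)
  also have "{l\<in>e - {i}. \<sigma> $ l \<noteq> \<sigma> $ i} = {l\<in>e. \<sigma> $ l \<noteq> \<sigma> $ i}" by auto
  also have "real (card (e - {i})) = real k - 1"
  proof -
    have "card (insert i (e - {i})) = Suc (card (e - {i}))"
      by (rule card_insert_disjoint) (use e' in simp_all)
    then show ?thesis using e'(3) e(2) by (simp add: insert_absorb)
  qed
  finally show ?thesis by simp
qed

lemma card_opposite_less:
  assumes e: "e \<in> nsets {..<n} k" "i \<in> e"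
  shows "card {l\<in>e. \<sigma> $ l \<noteq> \<sigma> $ i} < k"
proof -
  have "finite e" "card e = k" using e by (auto simp: nsets_def)
  moreover have "{l\<in>e. \<sigma> $ l \<noteq> \<sigma> $ i} \<subset> e" using e(2) by auto
  ultimately show ?thesis using psubset_card_mono by blast
qed

text \<open>By hypothesis \<open>A\<close> every hyperedge of \<open>H\<close> through
  \<open>i\<close> lies in one of the classes. Grouping by type \<open>r\<close> then gives all
  members of a class the same weight, by \<open>sign_sum_eq\<close>.\<close>

lemma local_field_eq:
  assumes H: "H \<subseteq> nsets {..<n} k" and \<sigma>: "\<sigma> \<in> sign_vec n"
    and A: "\<And>e. e \<in> H \<Longrightarrow> i \<in> e \<Longrightarrow> e \<inter> A = {i}"
  shows "local_field H \<sigma> i =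
    (\<Sum>r<k. (real k - 1 - 2 * real r) * real (card (local_class n k \<sigma> A i r \<inter> H)))"
proof -
  have finH: "finite H"
    by (rule finite_subset[OF H]) (simp add: finite_imp_finite_nsets)
  let ?S = "{e\<in>H. i \<in> e}" and ?g = "\<lambda>e. card {l\<in>e. \<sigma> $ l \<noteq> \<sigma> $ i}"
  have "local_field H \<sigma> i = (\<Sum>e\<in>?S. real k - 1 - 2 * real (?g e))"
    unfolding local_field_def by (rule sum.cong[OF refl]) (use sign_sum_eq[OF \<sigma>] H in blast)
  also have "\<dots> = (\<Sum>r<k. \<Sum>e\<in>{e\<in>?S. ?g e = r}. real k - 1 - 2 * real (?g e))"
  proof (rule sum.group[symmetric])
    show "?g ` ?S \<subseteq> {..<k}"
    proof (rule image_subsetI)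
      fix e assume "e \<in> ?S"
      then show "?g e \<in> {..<k}" using card_opposite_less[of e n k i \<sigma>] H by auto
    qed
  qed (use finH in simp_all)
  also have "\<dots> = (\<Sum>r<k. (real k - 1 - 2 * real r) * real (card (local_class n k \<sigma> A i r \<inter> H)))"
  proof (rule sum.cong[OF refl])
    fix r
    have "{e\<in>?S. ?g e = r} = local_class n k \<sigma> A i r \<inter> H"
      using H A by (auto simp: local_class_def)
    moreover have "(\<Sum>e\<in>{e\<in>?S. ?g e = r}. real k - 1 - 2 * real (?g e)) =
        (\<Sum>e\<in>{e\<in>?S. ?g e = r}. real k - 1 - 2 * real r)"
      by (rule sum.cong) auto
    ultimately show "(\<Sum>e\<in>{e\<in>?S. ?g e = r}. real k - 1 - 2 * real (?g e)) =
        (real k - 1 - 2 * real r) * real (card (local_class n k \<sigma> A i r \<inter> H))" by simp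
  qed
  finally show ?thesis .
qed

text \<open>Besides \<open>i\<close>, such a hyperedge consists of \<open>r\<close> untested
  vertices from the opposite side and \<open>k - 1 - r\<close> untested vertices from the side of
  \<open>i\<close>, chosen freely; intersecting with the two sides recovers the choice.\<close>

lemma card_local_class:
  assumes i: "i \<in> A" "A \<subseteq> {..<n}" and r: "r < k"
  shows "card (local_class n k \<sigma> A i r) =
    (card {l\<in>{..<n} - A. \<sigma> $ l \<noteq> \<sigma> $ i} choose r) *
    (card {l\<in>{..<n} - A. \<sigma> $ l = \<sigma> $ i} choose (k - 1 - r))"
proof -
  let ?O = "{l\<in>{..<n} - A. \<sigma> $ l \<noteq> \<sigma> $ i}" and ?U = "{l\<in>{..<n} - A. \<sigma> $ l = \<sigma> $ i}"
  have "bij_betw (\<lambda>(S, T). insert i (S \<union> T)) (nsets ?O r \<times> nsets ?U (k - 1 - r)) (local_class n k \<sigma> A i r)"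
  proof (rule bij_betw_byWitness[where f' = "\<lambda>e. (e \<inter> ?O, e \<inter> ?U)"])
    show "\<forall>a\<in>nsets ?O r \<times> nsets ?U (k - 1 - r).
        (\<lambda>e. (e \<inter> ?O, e \<inter> ?U)) ((\<lambda>(S, T). insert i (S \<union> T)) a) = a"
      using i by (auto simp: nsets_def)
    show "\<forall>e\<in>local_class n k \<sigma> A i r. (\<lambda>(S, T). insert i (S \<union> T)) (e \<inter> ?O, e \<inter> ?U) = e"
      using i by (auto simp: local_class_def nsets_def)
    show "(\<lambda>(S, T). insert i (S \<union> T)) ` (nsets ?O r \<times> nsets ?U (k - 1 - r)) \<subseteq> local_class n k \<sigma> A i r"
    proof (rule image_subsetI)
      fix a assume "a \<in> nsets ?O r \<times> nsets ?U (k - 1 - r)"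
      then obtain S T where a: "a = (S, T)" and S: "S \<in> nsets ?O r" and T: "T \<in> nsets ?U (k - 1 - r)"
        by blast
      have ST: "S \<inter> T = {}" "finite S" "finite T" "card S = r" "card T = k - 1 - r" "i \<notin> S \<union> T"
        "S \<subseteq> ?O" "T \<subseteq> ?U"
        using S T i by (auto simp: nsets_def)
      have "card (insert i (S \<union> T)) = k"
        using ST r by (simp add: card_Un_disjoint)
      moreover have "{l\<in>insert i (S \<union> T). \<sigma> $ l \<noteq> \<sigma> $ i} = S" using ST by auto
      moreover have "insert i (S \<union> T) \<inter> A = {i}" using ST i by auto
      moreover have "insert i (S \<union> T) \<subseteq> {..<n}" using ST i by auto
      ultimately show "(\<lambda>(S, T). insert i (S \<union> T)) a \<in> local_class n k \<sigma> A i r"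
        unfolding a using ST by (simp add: local_class_def nsets_def)
    qed
    show "(\<lambda>e. (e \<inter> ?O, e \<inter> ?U)) ` local_class n k \<sigma> A i r \<subseteq> nsets ?O r \<times> nsets ?U (k - 1 - r)"
    proof (rule image_subsetI)
      fix e assume e: "e \<in> local_class n k \<sigma> A i r"
      then have e': "e \<subseteq> {..<n}" "finite e" "card e = k" "e \<inter> A = {i}" "card {l\<in>e. \<sigma> $ l \<noteq> \<sigma> $ i} = r"
        by (auto simp: local_class_def nsets_def)
      have 1: "{l\<in>e. \<sigma> $ l \<noteq> \<sigma> $ i} = e \<inter> ?O" using e' by auto
      have "e = insert i ((e \<inter> ?O) \<union> (e \<inter> ?U))" using e' by auto
      then have "card e = card (insert i ((e \<inter> ?O) \<union> (e \<inter> ?U)))" by (rule arg_cong)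
      also have "\<dots> = Suc (card ((e \<inter> ?O) \<union> (e \<inter> ?U)))"
        using e'(2) i by (intro card_insert_disjoint) auto
      also have "card ((e \<inter> ?O) \<union> (e \<inter> ?U)) = card (e \<inter> ?O) + card (e \<inter> ?U)"
        using e'(2) by (intro card_Un_disjoint) auto
      finally have "card (e \<inter> ?U) = k - 1 - r" "card (e \<inter> ?O) = r"
        using e'(3,5) 1 by simp_all
      then show "(e \<inter> ?O, e \<inter> ?U) \<in> nsets ?O r \<times> nsets ?U (k - 1 - r)"
        using e'(2) by (simp add: nsets_def)
    qed
  qed
  then have "card (local_class n k \<sigma> A i r) = card (nsets ?O r \<times> nsets ?U (k - 1 - r))"
    by (rule bij_betw_same_card[symmetric])
  then show ?thesis by (simp add: card_cartesian_product)
qed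

text \<open>Union bound over a second tested vertex \<open>l\<close>: removing \<open>i\<close> and
  \<open>l\<close> injects the hyperedges through both into the \<open>(k - 2)\<close>-subsets of
  the other \<open>n - 2\<close> vertices.\<close>

lemma card_crossing_le:
  assumes i: "i < n" and A: "A \<subseteq> {..<n}" and k: "k \<ge> 2"
  shows "card {e \<in> nsets {..<n} k. i \<in> e \<and> e \<inter> (A - {i}) \<noteq> {}} \<le> card A * ((n - 2) choose (k - 2))"
proof -
  have fA: "finite A" using A finite_subset by blast
  let ?E = "\<lambda>l. {e \<in> nsets {..<n} k. i \<in> e \<and> l \<in> e}"
  have finE: "finite (?E l)" for l
    by (rule finite_subset[of _ "nsets {..<n} k"]) (auto simp: finite_imp_finite_nsets)
  have E: "card (?E l) \<le> (n - 2) choose (k - 2)" if l: "l \<in> A - {i}" for l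
  proof -
    have "card (?E l) \<le> card (nsets ({..<n} - {i, l}) (k - 2))"
    proof (rule card_inj_on_le[where f = "\<lambda>e. e - {i, l}"])
      show "inj_on (\<lambda>e. e - {i, l}) (?E l)" by (rule inj_onI) blast
      show "(\<lambda>e. e - {i, l}) ` ?E l \<subseteq> nsets ({..<n} - {i, l}) (k - 2)"
      proof (clarsimp)
        fix e assume e: "e \<in> nsets {..<n} k" "i \<in> e" "l \<in> e"
        have "card (e - {i, l}) = card e - card {i, l}"
          by (rule card_Diff_subset) (use e in auto)
        then show "e - {i, l} \<in> nsets ({..<n} - {i, l}) (k - 2)"
          using e l by (auto simp: nsets_def)
      qed
      show "finite (nsets ({..<n} - {i, l}) (k - 2))" by (rule finite_imp_finite_nsets) simp
    qed
    also have "\<dots> = (card ({..<n} - {i, l})) choose (k - 2)" by simp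
    also have "card ({..<n} - {i, l}) = card {..<n} - card {i, l}"
      by (rule card_Diff_subset) (use i l A in auto)
    also have "\<dots> = n - 2" using l by auto
    finally show ?thesis .
  qed
  have "card {e \<in> nsets {..<n} k. i \<in> e \<and> e \<inter> (A - {i}) \<noteq> {}} \<le> card (\<Union>l\<in>A - {i}. ?E l)"
    by (rule card_mono) (use fA finE in auto)
  also have "\<dots> \<le> (\<Sum>l\<in>A - {i}. card (?E l))" by (rule card_UN_le) (use fA in simp)
  also have "\<dots> \<le> (\<Sum>l\<in>A - {i}. (n - 2) choose (k - 2))" by (rule sum_mono) (rule E)
  also have "\<dots> \<le> card A * ((n - 2) choose (k - 2))" using fA by (simp add: card_Diff1_le)
  finally show ?thesis .
qed

lemma card_balanced_sign:
  assumes \<sigma>: "\<sigma> \<in> balanced_sign_vec n" and n: "even n"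
  shows "card {i. i < n \<and> \<sigma> $ i = 1} = n div 2" "card {i. i < n \<and> \<sigma> $ i = -1} = n div 2"
proof -
  let ?P = "{i. i < n \<and> \<sigma> $ i = 1}" and ?N = "{i. i < n \<and> \<sigma> $ i = -1}"
  have "{..<n} = ?P \<union> ?N" using \<sigma> by (auto simp: balanced_sign_vec_def sign_vec_def)
  then have "card {..<n} = card (?P \<union> ?N)" by (rule arg_cong)
  also have "\<dots> = card ?P + card ?N" by (rule card_Un_disjoint) auto
  finally have "n = card ?P + card ?N" by simp
  moreover have "card ?P = card ?N" using \<sigma> by (simp add: balanced_sign_vec_def)
  ultimately show "card ?P = n div 2" "card ?N = n div 2" by simp_all
qed

text \<open>
  Only a small set \<open>A\<close> of \<open>a\<close> vertices per side is tested: hyperedges meeting \<open>A\<close> in a single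
  vertex make the tests independent, and few hyperedges meet \<open>A\<close> twice.
\<close>

lemma prob_not_improvable_le:
  fixes p q :: real and m :: "nat \<Rightarrow> nat"
  defines "x n a \<equiv> n div 2 - a"
  defines "\<pi> n k a \<equiv> (\<Prod>r<k. pmf (binomial_pmf ((x n a choose r) * (x n a choose (k - 1 - r)))
      (if r = 0 then p else q)) (m r))"
  assumes k: "k \<ge> 2" and n: "even n" and \<sigma>: "\<sigma> \<in> balanced_sign_vec n" and a: "a \<le> n div 2"
    and pq: "0 \<le> q" "q \<le> p" "p \<le> 1"
    and neg: "(\<Sum>r<k. (real k - 1 - 2 * real r) * real (m r)) < 0"
  shows "measure_pmf.prob (Pi_pmf (nsets {..<n} k) False
      (\<lambda>e. bernoulli_pmf (if \<forall>i\<in>e. \<forall>j\<in>e. \<sigma> $ i = \<sigma> $ j then p else q)))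
      {f. \<not> improvable n {e \<in> nsets {..<n} k. f e} \<sigma>} \<le>
    2 * ((1 - \<pi> n k a) ^ a + real (2 * a * ((n - 2) choose (k - 2))) * p)"
proof -
  let ?V = "nsets {..<n} k"
  let ?b = "\<lambda>e. if \<forall>i\<in>e. \<forall>j\<in>e. \<sigma> $ i = \<sigma> $ j then p else q"
  let ?M = "Pi_pmf ?V False (\<lambda>e. bernoulli_pmf (?b e))"
  have finV: "finite ?V" by (rule finite_imp_finite_nsets) simp
  have \<sigma>s: "\<sigma> \<in> sign_vec n" using \<sigma> by (simp add: balanced_sign_vec_def)
  let ?P = "{i. i < n \<and> \<sigma> $ i = 1}" and ?N = "{i. i < n \<and> \<sigma> $ i = -1}"
  note cardPN = card_balanced_sign[OF \<sigma> n]
  obtain P where P: "P \<subseteq> ?P" "card P = a" "finite P"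
    by (rule obtain_subset_with_card_n[of a ?P]) (use a cardPN in simp_all)
  obtain N where N: "N \<subseteq> ?N" "card N = a" "finite N"
    by (rule obtain_subset_with_card_n[of a ?N]) (use a cardPN in simp_all)
  define A where "A = P \<union> N"
  have A: "A \<subseteq> {..<n}" "finite A" using P N by (auto simp: A_def)
  have "P \<inter> N = {}"
  proof -
    have "\<sigma> $ l = 1" "\<sigma> $ l = -1" if "l \<in> P \<inter> N" for l using that P(1) N(1) by auto
    then show ?thesis by fastforce
  qed
  then have cardA: "card A = 2 * a"
    unfolding A_def by (simp add: card_Un_disjoint P N)
  have side: "card {l\<in>{..<n} - A. \<sigma> $ l = 1} = x n a" "card {l\<in>{..<n} - A. \<sigma> $ l = -1} = x n a"
  proof -
    have "l \<notin> N" if "\<sigma> $ l = 1" for l using N(1) that by auto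
    then have "{l\<in>{..<n} - A. \<sigma> $ l = 1} = ?P - P" unfolding A_def by blast
    moreover have "l \<notin> P" if "\<sigma> $ l = -1" for l using P(1) that by auto
    then have "{l\<in>{..<n} - A. \<sigma> $ l = -1} = ?N - N" unfolding A_def by blast
    ultimately show "card {l\<in>{..<n} - A. \<sigma> $ l = 1} = x n a" "card {l\<in>{..<n} - A. \<sigma> $ l = -1} = x n a"
      using P N cardPN by (simp_all add: card_Diff_subset x_def)
  qed
  \<comment> \<open>Since \<open>A\<close> takes equally many vertices from both sides, the untested
    counts look the same from either side. This gives all tested vertices the same success
    probability.\<close>
  have sides: "card {l\<in>{..<n} - A. \<sigma> $ l \<noteq> \<sigma> $ i} = x n a" "card {l\<in>{..<n} - A. \<sigma> $ l = \<sigma> $ i} = x n a"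
    if i: "i \<in> A" for i
  proof -
    have i1: "\<sigma> $ i = 1 \<or> \<sigma> $ i = -1" using i A \<sigma>s by (auto simp: sign_vec_def)
    then show "card {l\<in>{..<n} - A. \<sigma> $ l = \<sigma> $ i} = x n a" by (elim disjE) (simp_all only: side)
    have "{l\<in>{..<n} - A. \<sigma> $ l \<noteq> \<sigma> $ i} = {l\<in>{..<n} - A. \<sigma> $ l = - \<sigma> $ i}"
    proof (rule Collect_cong)
      fix l
      show "(l \<in> {..<n} - A \<and> \<sigma> $ l \<noteq> \<sigma> $ i) = (l \<in> {..<n} - A \<and> \<sigma> $ l = - \<sigma> $ i)"
      proof (cases "l < n")
        case True
        then have "\<sigma> $ l = 1 \<or> \<sigma> $ l = -1" using \<sigma>s by (auto simp: sign_vec_def)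
        then show ?thesis using i1 by auto
      qed simp
    qed
    moreover have "card {l\<in>{..<n} - A. \<sigma> $ l = - \<sigma> $ i} = x n a"
      using i1 by (elim disjE) (simp_all only: side minus_minus)
    ultimately show "card {l\<in>{..<n} - A. \<sigma> $ l \<noteq> \<sigma> $ i} = x n a" by simp
  qed
  let ?C = "local_class n k \<sigma> A"
  \<comment> \<open>\<open>S i\<close> is the block of coordinates for the test at \<open>i\<close>,
    and \<open>G i\<close> says that its type counts are exactly the prescribed \<open>m\<close>.
    \<open>X i\<close> collects the hyperedges through \<open>i\<close> and another tested vertex,
    and \<open>B i\<close> says that one of them is present.\<close>
  define S where "S i = {e \<in> ?V. e \<inter> A = {i}}" for i
  define G where "G i f \<longleftrightarrow> (\<forall>r\<in>{..<k}. card {e\<in>?C i r. f e} = m r)" for i and f :: "nat set \<Rightarrow> bool"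
  define X where "X i = {e \<in> ?V. i \<in> e \<and> e \<inter> (A - {i}) \<noteq> {}}" for i
  define B where "B i f \<longleftrightarrow> (\<exists>e\<in>X i. f e)" for i and f :: "nat set \<Rightarrow> bool"
  have probG: "measure_pmf.prob ?M {f. G i f} = \<pi> n k a" if i: "i \<in> A" for i
  proof -
    have "measure_pmf.prob ?M {f. G i f} =
        (\<Prod>r\<in>{..<k}. pmf (binomial_pmf (card (?C i r)) (if r = 0 then p else q)) (m r))"
      unfolding G_def
    proof (rule prob_cards_eq_prod_binomial[OF finV])
      show "disjoint_family_on (?C i) {..<k}"
        unfolding disjoint_family_on_def local_class_def by blast
      show "?C i r \<subseteq> ?V" for r by (auto simp: local_class_def)
      show "(if r = 0 then p else q) \<in> {0..1}" for r :: nat using pq by auto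
      fix r e assume "e \<in> ?C i r"
      then have e: "finite e" "i \<in> e" "card {l\<in>e. \<sigma> $ l \<noteq> \<sigma> $ i} = r"
        using i by (auto simp: local_class_def nsets_def)
      \<comment> \<open>A hyperedge through \<open>i\<close> is monochromatic exactly when no vertex
        of it is opposite to \<open>i\<close>, so type \<open>0\<close> has probability
        \<open>p\<close> and all other types have \<open>q\<close>.\<close>
      have "(\<forall>i\<in>e. \<forall>j\<in>e. \<sigma> $ i = \<sigma> $ j) \<longleftrightarrow> (\<forall>l\<in>e. \<sigma> $ l = \<sigma> $ i)"
      proof (intro iffI ballI)
        fix l assume "\<forall>i\<in>e. \<forall>j\<in>e. \<sigma> $ i = \<sigma> $ j" "l \<in> e"
        then show "\<sigma> $ l = \<sigma> $ i" using e(2) by blast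
      next
        fix j l assume *: "\<forall>l\<in>e. \<sigma> $ l = \<sigma> $ i" "j \<in> e" "l \<in> e"
        show "\<sigma> $ j = \<sigma> $ l" using *(1)[rule_format, OF *(2)] *(1)[rule_format, OF *(3)] by simp
      qed
      also have "\<dots> \<longleftrightarrow> {l\<in>e. \<sigma> $ l \<noteq> \<sigma> $ i} = {}" by blast
      also have "\<dots> \<longleftrightarrow> r = 0" unfolding e(3)[symmetric] using e(1) by simp
      finally show "bernoulli_pmf (?b e) = bernoulli_pmf (if r = 0 then p else q)" by simp
    qed simp
    also have "\<dots> = \<pi> n k a"
      unfolding \<pi>_def
    proof (rule prod.cong[OF refl])
      fix r assume "r \<in> {..<k}"
      then have "card (?C i r) = (x n a choose r) * (x n a choose (k - 1 - r))"
        using card_local_class[OF i A(1), of r k \<sigma>] sides[OF i] by simp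
      then show "pmf (binomial_pmf (card (?C i r)) (if r = 0 then p else q)) (m r) =
          pmf (binomial_pmf ((x n a choose r) * (x n a choose (k - 1 - r))) (if r = 0 then p else q)) (m r)"
        by simp
    qed
    finally show ?thesis .
  qed
  have probB: "measure_pmf.prob ?M {f. B i f} \<le> real (2 * a * ((n - 2) choose (k - 2))) * p"
    if i: "i \<in> A" for i
  proof -
    have "measure_pmf.prob ?M {f. B i f} \<le> real (card (X i)) * p"
      unfolding B_def by (rule prob_Pi_pmf_bernoulli_ex_le[OF finV]) (use pq in \<open>auto simp: X_def\<close>)
    also have "real (card (X i)) \<le> real (card A * ((n - 2) choose (k - 2)))"
      unfolding X_def of_nat_le_iff by (rule card_crossing_le) (use i A k in auto)
    finally show ?thesis using pq by (simp add: cardA mult_right_mono)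
  qed
  have fail: "measure_pmf.prob ?M {f. \<forall>i\<in>I. \<not> G i f \<or> B i f} \<le>
      (1 - \<pi> n k a) ^ a + real (2 * a * ((n - 2) choose (k - 2))) * p"
    if I: "I \<subseteq> A" "card I = a" for I
    unfolding I(2)[symmetric]
  proof (rule prob_all_fail_le[OF finV, where S = S])
    show "finite I" using I A finite_subset by blast
    show "S i \<subseteq> ?V" for i by (auto simp: S_def)
    show "disjoint_family_on S I" unfolding disjoint_family_on_def S_def by blast
    show "measure_pmf.prob ?M {f. G i f} = \<pi> n k (card I)" if "i \<in> I" for i using probG that I by auto
    show "measure_pmf.prob ?M {f. B i f} \<le> real (2 * card I * ((n - 2) choose (k - 2))) * p"
      if "i \<in> I" for i using probB that I by auto
    show "0 \<le> real (2 * card I * ((n - 2) choose (k - 2))) * p" using pq by simp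
    show "G i f = G i g" if fg: "\<And>e. e \<in> S i \<Longrightarrow> f e = g e" for i f g
    proof -
      have "{e\<in>?C i r. f e} = {e\<in>?C i r. g e}" for r
      proof (rule Collect_cong)
        fix e
        have "f e = g e" if "e \<in> ?C i r"
          by (rule fg) (use that in \<open>simp add: S_def local_class_def\<close>)
        then show "(e \<in> ?C i r \<and> f e) = (e \<in> ?C i r \<and> g e)" by blast
      qed
      then show ?thesis by (simp add: G_def)
    qed
    \<comment> \<open>A hyperedge in \<open>X i\<close> meets \<open>A\<close> in at least two
      vertices and therefore belongs to no block \<open>S j\<close>.\<close>
    show "B i f = B i g" if i: "i \<in> I" and fg: "\<And>e. e \<in> ?V - (\<Union>j\<in>I. S j) \<Longrightarrow> f e = g e" for i f g
      unfolding B_def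
    proof (rule bex_cong[OF refl])
      fix e assume "e \<in> X i"
      then obtain l where e: "e \<in> ?V" "i \<in> e \<inter> A" "l \<in> e \<inter> A" "l \<noteq> i"
        using i I by (auto simp: X_def)
      have "e \<inter> A \<noteq> {j}" for j
        using e(2-4) by (metis singletonD)
      then have "e \<in> ?V - (\<Union>j\<in>I. S j)" using e(1) by (simp add: S_def)
      then show "f e = g e" by (rule fg)
    qed
  qed
  \<comment> \<open>One successful test on each side suffices: both local fields equal the negative
    sum in \<open>neg\<close>, and \<open>\<not> B i f\<close> excludes a hyperedge containing both
    \<open>i\<close> and \<open>j\<close>. So if no swap improves, all tests fail on
    \<open>P\<close> or all fail on \<open>N\<close>.\<close>
  have imp: "improvable n {e \<in> ?V. f e} \<sigma>"
    if ij: "i \<in> P" "G i f" "\<not> B i f" "j \<in> N" "G j f" "\<not> B j f" for f i j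
  proof -
    let ?H = "{e \<in> ?V. f e}"
    have lf: "local_field ?H \<sigma> l < 0" if l: "l \<in> A" "G l f" "\<not> B l f" for l
    proof -
      have "e \<inter> A = {l}" if "e \<in> ?H" "l \<in> e" for e
        using l that by (auto simp: B_def X_def)
      then have "local_field ?H \<sigma> l =
          (\<Sum>r<k. (real k - 1 - 2 * real r) * real (card (?C l r \<inter> ?H)))"
        by (intro local_field_eq[OF _ \<sigma>s]) auto
      also have "\<dots> = (\<Sum>r<k. (real k - 1 - 2 * real r) * real (m r))"
      proof (rule sum.cong[OF refl])
        fix r assume r: "r \<in> {..<k}"
        have "?C l r \<inter> ?H = {e\<in>?C l r. f e}" by (auto simp: local_class_def)
        then show "(real k - 1 - 2 * real r) * real (card (?C l r \<inter> ?H)) =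
            (real k - 1 - 2 * real r) * real (m r)" using l(2) r by (simp add: G_def)
      qed
      finally show ?thesis using neg by simp
    qed
    have iA: "i \<in> A" "j \<in> A" and i: "i < n" "\<sigma> $ i = 1" and j: "j < n" "\<sigma> $ j = -1"
      using ij P N by (auto simp: A_def)
    then have "i \<noteq> j" by auto
    have "\<not> (i \<in> e \<and> j \<in> e)" if "e \<in> ?H" for e
      using ij(3) that iA \<open>i \<noteq> j\<close> by (auto simp: B_def X_def)
    moreover have "local_field ?H \<sigma> i + local_field ?H \<sigma> j < 0"
      using lf[OF iA(1) ij(2,3)] lf[OF iA(2) ij(5,6)] by simp
    ultimately show ?thesis unfolding improvable_def using i j by blast
  qed
  have "measure_pmf.prob ?M {f. \<not> improvable n {e \<in> ?V. f e} \<sigma>} \<le>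
      measure_pmf.prob ?M ({f. \<forall>i\<in>P. \<not> G i f \<or> B i f} \<union> {f. \<forall>i\<in>N. \<not> G i f \<or> B i f})"
    by (rule measure_pmf.finite_measure_mono) (use imp in \<open>simp_all add: subset_eq\<close>, blast)
  also have "\<dots> \<le> measure_pmf.prob ?M {f. \<forall>i\<in>P. \<not> G i f \<or> B i f} +
      measure_pmf.prob ?M {f. \<forall>i\<in>N. \<not> G i f \<or> B i f}"
    by (rule measure_Un_le) simp_all
  also have "\<dots> \<le> 2 * ((1 - \<pi> n k a) ^ a + real (2 * a * ((n - 2) choose (k - 2))) * p)"
    using fail[of P] fail[of N] P N by (simp add: A_def)
  finally show ?thesis .
qed

section \<open>Asymptotics\<close>

text \<open>A crude Stirling bound by induction from
  \<open>ln (m / (m + 1)) \<le> - 1 / (m + 1)\<close>. The surplus \<open>1 + ln m\<close> is of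
  lower order than \<open>m\<close>, which is all that the exponent needs.\<close>

lemma ln_fact_le:
  assumes "m \<ge> 1"
  shows "ln (fact m :: real) \<le> real m * ln (real m) - real m + 1 + ln (real m)"
  using assms
proof (induction m rule: dec_induct)
  case (step m)
  have m: "real m \<ge> 1" using step by simp
  have "ln (real m / real (Suc m)) \<le> real m / real (Suc m) - 1"
    by (rule ln_le_minus_one) (use m in simp)
  also have "\<dots> = - (1 / real (Suc m))" by (simp add: field_simps)
  finally have "1 / real (Suc m) \<le> ln (real (Suc m)) - ln (real m)"
    using m by (simp add: ln_div)
  then have "1 \<le> real (Suc m) * (ln (real (Suc m)) - ln (real m))"
    by (simp add: field_simps)
  then have "real m * ln (real m) + ln (real m) + 1 \<le> real m * ln (real (Suc m)) + ln (real (Suc m))"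
    by (simp add: algebra_simps)
  moreover have "ln (fact (Suc m) :: real) = ln (real (Suc m)) + ln (fact m)"
    using fact_Suc[of m, where ?'a = real] ln_mult[of "real (Suc m)" "fact m"] by simp
  ultimately show ?case using step.IH by (simp add: algebra_simps)
qed simp

text \<open>The right-hand side is a falling factorial with \<open>m\<close> factors, each at least
  \<open>N - m\<close>; the induction uses the absorption identities.\<close>

lemma power_le_fact_mult_binomial:
  assumes "m \<le> N"
  shows "(N - m) ^ m \<le> fact m * (N choose m)"
  using assms
proof (induction m)
  case (Suc m)
  have "(N - Suc m) ^ Suc m \<le> (N - m) ^ Suc m" by (rule power_mono) auto
  also have "\<dots> \<le> (N - m) * (fact m * (N choose m))" using Suc by (simp add: mult_left_mono)
  also have "\<dots> = fact m * ((N - m) * (N choose m))" by simp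
  also have "(N - m) * (N choose m) = Suc m * (N choose Suc m)"
    unfolding binomial_absorb_comp binomial_absorption ..
  finally show ?case by (simp add: algebra_simps)
qed simp

text \<open>\<open>N choose m\<close> is bounded through \<open>power_le_fact_mult_binomial\<close>,
  the factorial through \<open>ln_fact_le\<close>, and \<open>(1 - p) ^ (N - m)\<close> is replaced
  by the smaller \<open>(1 - p) ^ N\<close>. The logarithmic form is ready to be divided by the
  scale.\<close>

lemma pmf_binomial_ge_exp:
  assumes m: "0 < m" "m < N" and p: "0 < p" "p < 1"
  shows "pmf (binomial_pmf N p) m \<ge>
    exp (real m * ln ((real N - real m) * p / real m) + real m - 1 - ln (real m) + real N * ln (1 - p))"
proof -
  define x where "x = (real N - real m) * p"
  have x: "x > 0" using m p by (simp add: x_def)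
  have "real m * ln (x / real m) + real m - 1 - ln (real m) + real N * ln (1 - p)
      \<le> real m * ln x - ln (fact m) + real (N - m) * ln (1 - p)"
  proof -
    have "real N * ln (1 - p) \<le> real (N - m) * ln (1 - p)"
      by (rule mult_right_mono_neg) (use p in auto)
    moreover have "real m * ln (x / real m) = real m * ln x - real m * ln (real m)"
      using x m by (simp add: ln_div right_diff_distrib)
    moreover have "ln (fact m :: real) \<le> real m * ln (real m) - real m + 1 + ln (real m)"
      using m by (intro ln_fact_le) simp
    ultimately show ?thesis by linarith
  qed
  then have "exp (real m * ln (x / real m) + real m - 1 - ln (real m) + real N * ln (1 - p))
      \<le> exp (real m * ln x - ln (fact m) + real (N - m) * ln (1 - p))" by simp
  also have "\<dots> = x ^ m / fact m * (1 - p) ^ (N - m)"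
    using x p by (simp add: exp_add exp_diff exp_of_nat_mult)
  also have "\<dots> \<le> real (N choose m) * p ^ m * (1 - p) ^ (N - m)"
  proof (rule mult_right_mono)
    have "real ((N - m) ^ m) \<le> real (fact m * (N choose m))"
      using power_le_fact_mult_binomial[of m N] m by (simp only: of_nat_le_iff)
    then have "(real N - real m) ^ m \<le> fact m * real (N choose m)" using m by (simp add: of_nat_diff)
    then have "(real N - real m) ^ m * p ^ m \<le> fact m * real (N choose m) * p ^ m"
      using p by (intro mult_right_mono) auto
    then have "x ^ m \<le> fact m * real (N choose m) * p ^ m"
      unfolding x_def power_mult_distrib .
    then show "x ^ m / fact m \<le> real (N choose m) * p ^ m"
      by (simp add: pos_divide_le_eq mult_ac)
  qed (use p in simp)
  also have "\<dots> = pmf (binomial_pmf N p) m" using p m by simp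
  finally show ?thesis by (simp add: x_def)
qed

text \<open>
  The exponent \<open>c * ln (\<mu> / c) + c - \<mu>\<close> is that of a Poisson variable of mean \<open>\<mu> L\<close>
  at the point \<open>c L\<close>.
\<close>

lemma eventually_pmf_binomial_ge:
  fixes N m :: "nat \<Rightarrow> nat" and p L :: "nat \<Rightarrow> real"
  assumes L: "filterlim L at_top sequentially"
    and p: "filterlim p (at_right 0) sequentially"
    and N: "(\<lambda>n. real (N n) * p n / L n) \<longlonglongrightarrow> \<mu>" and m: "(\<lambda>n. real (m n) / L n) \<longlonglongrightarrow> c"
    and pos: "\<mu> > 0" "c > 0" and \<epsilon>: "\<epsilon> > 0"
  shows "\<forall>\<^sub>F n in sequentially. pmf (binomial_pmf (N n) (p n)) (m n) \<ge>
    exp (L n * (c * ln (\<mu> / c) + c - \<mu> - \<epsilon>))"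
proof -
  have p0: "p \<longlonglongrightarrow> 0" using p by (auto simp: filterlim_at)
  have ppos: "\<forall>\<^sub>F n in sequentially. p n > 0"
    using p by (auto simp: filterlim_at elim: eventually_mono)
  have plt1: "\<forall>\<^sub>F n in sequentially. p n < 1" by (rule order_tendstoD[OF p0]) simp
  have Lpos: "\<forall>\<^sub>F n in sequentially. L n > 0" using L by (rule filterlim_at_top_dense[THEN iffD1, rule_format])
  have mpos: "\<forall>\<^sub>F n in sequentially. real (m n) / L n > 0" by (rule order_tendstoD[OF m]) (rule pos)
  have Nm: "(\<lambda>n. real (N n) * p n / L n - real (m n) / L n * p n) \<longlonglongrightarrow> \<mu> - c * 0"
    by (intro tendsto_intros N m p0)
  then have Nmpos: "\<forall>\<^sub>F n in sequentially. real (N n) * p n / L n - real (m n) / L n * p n > 0"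
    using pos by (intro order_tendstoD) auto
  \<comment> \<open>Needed so that the Stirling surplus \<open>ln m / m\<close> vanishes.\<close>
  have mtop: "filterlim (\<lambda>n. real (m n)) at_top sequentially"
  proof (rule filterlim_cong[THEN iffD1, OF refl refl])
    show "\<forall>\<^sub>F n in sequentially. real (m n) / L n * L n = real (m n)"
      using Lpos by eventually_elim simp
    show "filterlim (\<lambda>n. real (m n) / L n * L n) at_top sequentially"
      by (rule filterlim_tendsto_pos_mult_at_top[OF m pos(2) L])
  qed
  \<comment> \<open>\<open>g\<close> is the exponent of \<open>pmf_binomial_ge_exp\<close> divided
    by \<open>L\<close>, rearranged into quantities whose limits are known.\<close>
  define g where "g n = real (m n) / L n * ln ((real (N n) * p n / L n - real (m n) / L n * p n) / (real (m n) / L n))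
      + real (m n) / L n - 1 / L n - real (m n) / L n * (ln (real (m n)) / real (m n))
      + real (N n) * p n / L n * (ln (1 - p n) / p n)" for n
  \<comment> \<open>This limit turns the term \<open>N * ln (1 - p) / L\<close> into
    \<open>- \<mu>\<close>; it is taken from the right at \<open>0\<close>, where \<open>p\<close>
    is nonzero.\<close>
  have "(\<lambda>n. ln (1 - p n) / p n) \<longlonglongrightarrow> - 1"
  proof (rule filterlim_compose[OF _ p])
    show "((\<lambda>x::real. ln (1 - x) / x) \<longlongrightarrow> - 1) (at_right 0)" by real_asymp
  qed
  moreover have "(\<lambda>n. ln (real (m n)) / real (m n)) \<longlonglongrightarrow> 0"
    by (rule filterlim_compose[OF _ mtop]) real_asymp
  moreover have "(\<lambda>n. 1 / L n) \<longlonglongrightarrow> 0"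
    by (rule filterlim_compose[OF _ L]) real_asymp
  ultimately have "g \<longlonglongrightarrow> c * ln ((\<mu> - c * 0) / c) + c - 0 - c * 0 + \<mu> * (- 1)"
    unfolding g_def using pos by (intro tendsto_intros Nm N m) auto
  then have "\<forall>\<^sub>F n in sequentially. g n > c * ln (\<mu> / c) + c - \<mu> - \<epsilon>"
    using \<epsilon> by (intro order_tendstoD) auto
  then show ?thesis using ppos plt1 Lpos mpos Nmpos
  proof eventually_elim
    case (elim n)
    have m0: "real (m n) > 0" using elim by (simp add: zero_less_divide_iff)
    have "(real (N n) - real (m n)) * p n > 0"
    proof -
      have "(real (N n) - real (m n)) * p n / L n > 0" using elim by (simp add: field_simps)
      then show ?thesis using elim by (simp add: zero_less_divide_iff)
    qed
    then have mN: "m n < N n" using elim by (simp add: zero_less_mult_iff)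
    have q: "(real (N n) * p n / L n - real (m n) / L n * p n) / (real (m n) / L n) =
        (real (N n) - real (m n)) * p n / real (m n)"
      using elim m0 by (simp add: field_simps)
    have "L n * (c * ln (\<mu> / c) + c - \<mu> - \<epsilon>) \<le> L n * g n"
      using elim by (intro mult_left_mono) auto
    also have "L n * g n = real (m n) * ln ((real (N n) - real (m n)) * p n / real (m n)) + real (m n) - 1
        - ln (real (m n)) + real (N n) * ln (1 - p n)"
      unfolding g_def q using elim m0 by (simp add: field_simps)
    finally have "exp (L n * (c * ln (\<mu> / c) + c - \<mu> - \<epsilon>)) \<le> exp (real (m n) * ln ((real (N n) - real (m n)) * p n / real (m n)) + real (m n) - 1
        - ln (real (m n)) + real (N n) * ln (1 - p n))" by simp
    also have "\<dots> \<le> pmf (binomial_pmf (N n) (p n)) (m n)"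
      by (rule pmf_binomial_ge_exp) (use m0 mN elim in auto)
    finally show ?case .
  qed
qed

section \<open>The rate function and its critical point\<close>

text \<open>The limiting mean number of type-\<open>r\<close> hyperedges through a vertex, in units
  of \<open>ln n\<close>: of the \<open>k - 1\<close> other vertices, \<open>r\<close> fall into the
  opposite half with the binomial weight of fair coin flips.\<close>

definition class_rate :: "nat \<Rightarrow> real \<Rightarrow> real \<Rightarrow> nat \<Rightarrow> real" where
  "class_rate k \<alpha> \<beta> r = (if r = 0 then \<alpha> else \<beta>) * real ((k - 1) choose r) / 2 ^ (k - 1)"

lemma I2_fun_eq_sum:
  assumes "k \<ge> 2"
  shows "I2_fun k \<alpha> \<beta> t = (\<Sum>r<k. class_rate k \<alpha> \<beta> r * (1 - exp (- ((real k - 1 - 2 * real r) * t))))"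
proof -
  let ?f = "\<lambda>r. class_rate k \<alpha> \<beta> r * (1 - exp (- ((real k - 1 - 2 * real r) * t)))"
  have "{..<k} = insert 0 {1..k - 1}" using assms by auto
  then have "(\<Sum>r<k. ?f r) = ?f 0 + (\<Sum>r = 1..k - 1. ?f r)"
    by (simp only:) (rule sum.insert, auto)
  also have "(\<Sum>r = 1..k - 1. ?f r) = (\<Sum>r = 1..k - 1. 1 / 2 ^ (k - 1) * (\<beta> * (real ((k - 1) choose r) *
      (1 - exp (- (real k - 1 - 2 * real r) * t)))))"
    by (rule sum.cong) (simp_all add: class_rate_def mult_ac del: minus_diff_eq)
  also have "\<dots> = 1 / 2 ^ (k - 1) * (\<beta> * (\<Sum>r = 1..k - 1. real ((k - 1) choose r) *
      (1 - exp (- (real k - 1 - 2 * real r) * t))))"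
    by (simp only: sum_distrib_left)
  also have "?f 0 = 1 / 2 ^ (k - 1) * (\<alpha> * (1 - exp (- (real k - 1) * t)))"
    by (simp add: class_rate_def mult_ac del: minus_diff_eq)
  finally show ?thesis by (simp only: I2_fun_def distrib_left)
qed

text \<open>The reflection \<open>r \<mapsto> k - 1 - r\<close> preserves the binomial coefficient
  and negates the weight.\<close>

lemma sum_binomial_antisymmetric:
  assumes "k \<ge> 1"
  shows "(\<Sum>r<k. (real k - 1 - 2 * real r) * real ((k - 1) choose r)) = 0"
proof -
  let ?f = "\<lambda>r. (real k - 1 - 2 * real r) * real ((k - 1) choose r)"
  have "(\<Sum>r<k. ?f r) = (\<Sum>r<k. ?f (k - Suc r))"
    by (rule sum.nat_diff_reindex[symmetric])
  also have "\<dots> = (\<Sum>r<k. - ?f r)"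
  proof (rule sum.cong[OF refl])
    fix r assume "r \<in> {..<k}"
    then have r: "r \<le> k - 1" "k - Suc r = k - 1 - r" using assms by auto
    have "((k - 1) choose (k - Suc r)) = ((k - 1) choose r)"
      unfolding r(2) by (rule binomial_symmetric[OF r(1), symmetric])
    then show "?f (k - Suc r) = - ?f r" using r(1) assms by (simp add: of_nat_diff algebra_simps)
  qed
  finally show ?thesis by (simp add: sum_negf)
qed

text \<open>The second equation is the vanishing of the derivative at a maximiser. As
  \<open>\<alpha> > \<beta>\<close>, the derivative at \<open>0\<close> is positive, so a maximiser
  over the nonnegative reals is positive, hence an interior local maximum.\<close>

lemma I2_critical_point:
  assumes k: "k \<ge> 2" and \<beta>: "0 < \<beta>" "\<beta> < \<alpha>"
  obtains t where
    "I2 k \<alpha> \<beta> = (\<Sum>r<k. class_rate k \<alpha> \<beta> r * (1 - exp (- ((real k - 1 - 2 * real r) * t))))"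
    "(\<Sum>r<k. (real k - 1 - 2 * real r) *
       (class_rate k \<alpha> \<beta> r * exp (- ((real k - 1 - 2 * real r) * t)))) = 0"
proof -
  let ?s = "\<lambda>r. real k - 1 - 2 * real r" and ?I = "I2_fun k \<alpha> \<beta>"
  let ?D = "\<lambda>t. \<Sum>r<k. ?s r * (class_rate k \<alpha> \<beta> r * exp (- (?s r * t)))"
  have I: "?I = (\<lambda>t. \<Sum>r<k. class_rate k \<alpha> \<beta> r * (1 - exp (- (?s r * t))))"
    by (rule ext) (rule I2_fun_eq_sum[OF k])
  have deriv: "((\<lambda>t. c * (1 - exp (- (s * t)))) has_real_derivative s * (c * exp (- (s * t)))) (at t)"
    for c s t :: real
    by (auto intro!: derivative_eq_intros)
  have D: "(?I has_real_derivative ?D t) (at t)" for t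
    unfolding I by (intro DERIV_sum deriv)
  obtain t where t: "t \<ge> 0" "I2 k \<alpha> \<beta> = ?I t" "\<And>s. s \<ge> 0 \<Longrightarrow> ?I s \<le> ?I t"
    using I2_is_max[of k \<alpha> \<beta>] k \<beta> by auto
  \<comment> \<open>At \<open>t = 0\<close>, with \<open>\<beta>\<close> in every term, the weights
    would cancel by antisymmetry; only the excess \<open>\<alpha> - \<beta>\<close> of type
    \<open>0\<close> remains.\<close>
  have "?D 0 = (\<Sum>r<k. \<beta> / 2 ^ (k - 1) * (?s r * real ((k - 1) choose r)) +
      (if r = 0 then (\<alpha> - \<beta>) * (real k - 1) / 2 ^ (k - 1) else 0))"
    by (rule sum.cong) (auto simp: class_rate_def field_simps)
  also have "\<dots> = \<beta> / 2 ^ (k - 1) * (\<Sum>r<k. ?s r * real ((k - 1) choose r)) +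
      (\<alpha> - \<beta>) * (real k - 1) / 2 ^ (k - 1)"
    unfolding sum.distrib sum_distrib_left[symmetric] using k by simp
  also have "(\<Sum>r<k. ?s r * real ((k - 1) choose r)) = 0"
    using k by (intro sum_binomial_antisymmetric) simp
  finally have "?D 0 > 0" using k \<beta> by simp
  then obtain d where d: "d > 0" "\<And>h. 0 < h \<Longrightarrow> h < d \<Longrightarrow> ?I 0 < ?I (0 + h)"
    using DERIV_pos_inc_right[OF D] by blast
  have "t > 0"
  proof (rule ccontr)
    assume "\<not> t > 0"
    then have "t = 0" using t by simp
    then show False using d(2)[of "d / 2"] d(1) t(3)[of "d / 2"] by simp
  qed
  then have "?D t = 0"
    using t(3) by (intro DERIV_local_max[OF D, of t]) auto
  then show ?thesis using that t(2) I2_fun_eq_sum[OF k] by simp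
qed

section \<open>Limits of binomial ratios, edge probabilities and the test set\<close>

text \<open>The falling factorial lies between \<open>(N - r) ^ r\<close> and
  \<open>N ^ r\<close>.\<close>

lemma tendsto_binomial_over_power:
  assumes x: "filterlim x at_top sequentially"
  shows "(\<lambda>n. real (x n choose r) / real (x n) ^ r) \<longlonglongrightarrow> 1 / fact r"
proof (rule filterlim_compose[OF _ x], rule tendsto_sandwich)
  show "\<forall>\<^sub>F N in at_top. ((real N - real r) / real N) ^ r * (1 / fact r) \<le> real (N choose r) / real N ^ r"
    using eventually_ge_at_top[of "r + 1"]
  proof eventually_elim
    case (elim N)
    have "real ((N - r) ^ r) \<le> real (fact r * (N choose r))"
      using power_le_fact_mult_binomial[of r N] elim by (simp only: of_nat_le_iff)
    then have "(real N - real r) ^ r \<le> fact r * real (N choose r)" using elim by (simp add: of_nat_diff)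
    then show ?case using elim by (simp add: power_divide field_simps)
  qed
  show "\<forall>\<^sub>F N in at_top. real (N choose r) / real N ^ r \<le> 1 / fact r"
    using eventually_gt_at_top[of 0]
  proof eventually_elim
    case (elim N)
    have "real ((N choose r) * fact r) \<le> real (N ^ r)"
      using binomial_fact_pow[of N r] by (simp only: of_nat_le_iff)
    then show ?case using elim by (simp add: field_simps)
  qed
  have "(\<lambda>N. (real N - real r) / real N) \<longlonglongrightarrow> 1" by real_asymp
  then have "(\<lambda>N. ((real N - real r) / real N) ^ r * (1 / fact r)) \<longlonglongrightarrow> 1 ^ r * (1 / fact r)"
    by (intro tendsto_intros)
  then show "(\<lambda>N. ((real N - real r) / real N) ^ r * (1 / fact r)) \<longlonglongrightarrow> 1 / fact r" by simp
qed simp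

lemma tendsto_binomial_product_ratio:
  fixes x :: "nat \<Rightarrow> nat"
  assumes x: "(\<lambda>n. real (x n) / real n) \<longlonglongrightarrow> 1 / 2" and r: "r \<le> d"
  shows "(\<lambda>n. real ((x n choose r) * (x n choose (d - r))) / real ((n - 1) choose d))
    \<longlonglongrightarrow> real (d choose r) / 2 ^ d"
proof -
  have xr: "filterlim (\<lambda>n. real (x n)) at_top sequentially"
  proof (rule filterlim_cong[THEN iffD1, OF refl refl])
    show "\<forall>\<^sub>F n in sequentially. real (x n) / real n * real n = real (x n)"
      using eventually_gt_at_top[of 0] by eventually_elim simp
    show "filterlim (\<lambda>n. real (x n) / real n * real n) at_top sequentially"
      by (rule filterlim_tendsto_pos_mult_at_top[OF x _ filterlim_real_sequentially]) simp
  qed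
  have xt: "filterlim x at_top sequentially"
    using xr by (simp add: filterlim_sequentially_iff_filterlim_real)
  have nt: "filterlim (\<lambda>n::nat. n - 1) at_top sequentially" by (rule filterlim_minus_const_nat_at_top)
  have n1: "(\<lambda>n. real n / real (n - 1)) \<longlonglongrightarrow> 1"
  proof (rule Lim_transform_eventually)
    show "(\<lambda>n. real n / (real n - 1)) \<longlonglongrightarrow> 1" by real_asymp
    show "\<forall>\<^sub>F n in sequentially. real n / (real n - 1) = real n / real (n - 1)"
      using eventually_ge_at_top[of 1] by eventually_elim (simp add: of_nat_diff)
  qed
  \<comment> \<open>The target ratio is factored into pieces with known limits;
    \<open>n / (n - 1)\<close> reconciles the scale \<open>n\<close> of the hypothesis with the
    scale \<open>n - 1\<close> of the denominator.\<close>
  have lim: "(\<lambda>n. (real (x n choose r) / real (x n) ^ r) * (real (x n choose (d - r)) / real (x n) ^ (d - r)) *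
      (real (x n) / real n) ^ d * (real n / real (n - 1)) ^ d / (real ((n - 1) choose d) / real (n - 1) ^ d))
      \<longlonglongrightarrow> (1 / fact r) * (1 / fact (d - r)) * (1 / 2) ^ d * 1 ^ d / (1 / fact d)"
    by (rule tendsto_divide[OF tendsto_mult[OF tendsto_mult[OF tendsto_mult[OF
          tendsto_binomial_over_power[OF xt] tendsto_binomial_over_power[OF xt]]
          tendsto_power[OF x]] tendsto_power[OF n1]] tendsto_binomial_over_power[OF nt]]) simp
  have "real (d choose r) = fact d / (fact r * fact (d - r))"
    using r by (rule binomial_fact)
  then have val: "(1 / fact r) * (1 / fact (d - r)) * (1 / 2) ^ d * 1 ^ d / (1 / fact d) = real (d choose r) / 2 ^ d"
    by (simp add: field_simps)
  show ?thesis
  proof (rule Lim_transform_eventually[OF lim[unfolded val]])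
    have "\<forall>\<^sub>F n in sequentially. x n > 0"
      by (rule eventually_compose_filterlim[OF eventually_gt_at_top xt])
    then show "\<forall>\<^sub>F n in sequentially. (real (x n choose r) / real (x n) ^ r) * (real (x n choose (d - r)) / real (x n) ^ (d - r)) *
        (real (x n) / real n) ^ d * (real n / real (n - 1)) ^ d / (real ((n - 1) choose d) / real (n - 1) ^ d) =
        real ((x n choose r) * (x n choose (d - r))) / real ((n - 1) choose d)"
      using eventually_gt_at_top[of 1]
    proof eventually_elim
      case (elim n)
      have "real (x n) ^ r * real (x n) ^ (d - r) = real (x n) ^ d"
        using r by (simp flip: power_add)
      then show ?case using elim by (simp add: power_divide field_simps)
    qed
  qed
qed

text \<open>The two binomial coefficients have ratio \<open>(k - 1) / (n - 1)\<close> by absorption.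
  With the larger edge probability this bounds the expected number of hyperedges through two given
  vertices, of order \<open>ln n / n\<close>.\<close>

lemma edge_prob_mult_binomial:
  assumes k: "2 \<le> k" "k \<le> n"
  shows "real ((n - 2) choose (k - 2)) * edge_prob k n c = (real k - 1) * c * ln (real n) / (real n - 1)"
proof -
  obtain k' n' where k': "k = Suc (Suc k')" and n': "n = Suc (Suc n')"
    using k by (metis add_2_eq_Suc le_Suc_ex order.trans)
  have "real (Suc k' * (Suc n' choose Suc k')) = real (Suc n' * (n' choose k'))"
    by (rule arg_cong[OF Suc_times_binomial])
  then have absorb: "real (Suc k') * real (Suc n' choose Suc k') = real (Suc n') * real (n' choose k')"
    by (simp only: of_nat_mult)
  have pos: "real (Suc n' choose Suc k') > 0" "real (Suc n') > 0"
    using k by (simp_all only: of_nat_0_less_iff zero_less_binomial_iff k' n')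
  have "real (n' choose k') / real (Suc n' choose Suc k') = real (Suc k') / real (Suc n')"
    using absorb pos by (simp add: field_simps del: of_nat_Suc binomial_Suc_Suc)
  moreover have "real ((n - 2) choose (k - 2)) * edge_prob k n c =
      real (n' choose k') / real (Suc n' choose Suc k') * (c * ln (real n))"
    by (simp add: edge_prob_def k' n')
  moreover have "real k - 1 = real (Suc k')" "real n - 1 = real (Suc n')" by (simp_all add: k' n')
  ultimately show ?thesis by (simp only: times_divide_eq_left mult.assoc)
qed

text \<open>Since \<open>(n - 2) choose (k - 2)\<close> is at least \<open>1\<close>, the bound from
  \<open>edge_prob_mult_binomial\<close> also covers a single hyperedge.\<close>

lemma filterlim_edge_prob:
  assumes k: "2 \<le> k" and c: "c > 0"
  shows "filterlim (\<lambda>n. edge_prob k n c) (at_right 0) sequentially"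
proof -
  have pos: "\<forall>\<^sub>F n in sequentially. edge_prob k n c > 0"
    using eventually_ge_at_top[of k]
  proof eventually_elim
    case (elim n)
    then have "real ((n - 1) choose (k - 1)) > 0" "ln (real n) > 0" using k by auto
    then show ?case using c by (simp add: edge_prob_def)
  qed
  have "(\<lambda>n. edge_prob k n c) \<longlonglongrightarrow> 0"
  proof (rule tendsto_sandwich)
    show "\<forall>\<^sub>F n in sequentially. edge_prob k n c \<le> (real k - 1) * c * ln (real n) / (real n - 1)"
      using eventually_ge_at_top[of k] pos
    proof eventually_elim
      case (elim n)
      then have "(n - 2) choose (k - 2) > 0" by simp
      then have "1 \<le> real ((n - 2) choose (k - 2))" by linarith
      then have "1 * edge_prob k n c \<le> real ((n - 2) choose (k - 2)) * edge_prob k n c"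
        using elim by (intro mult_right_mono) auto
      then show ?case using edge_prob_mult_binomial[of k n c] elim k by simp
    qed
    show "\<forall>\<^sub>F n in sequentially. 0 \<le> edge_prob k n c"
      using pos by eventually_elim simp
    show "(\<lambda>n. (real k - 1) * c * ln (real n) / (real n - 1)) \<longlonglongrightarrow> 0" by real_asymp
  qed simp
  then show ?thesis using pos
    by (auto simp: filterlim_at elim: eventually_mono)
qed

text \<open>Of order \<open>n powr (1 - o(1))\<close>, but \<open>o(n / ln n)\<close>.\<close>

definition test_size :: "nat \<Rightarrow> nat" where
  "test_size n = nat \<lfloor>real n / (ln (real n))\<^sup>2\<rfloor>"

lemma test_size_bounds:
  "real n / (ln (real n))\<^sup>2 - 1 \<le> real (test_size n)" "real (test_size n) \<le> real n / (ln (real n))\<^sup>2"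
proof -
  have "0 \<le> real n / (ln (real n))\<^sup>2" by simp
  then show "real n / (ln (real n))\<^sup>2 - 1 \<le> real (test_size n)" "real (test_size n) \<le> real n / (ln (real n))\<^sup>2"
    unfolding test_size_def by linarith+
qed

lemma test_size_over_n: "(\<lambda>n. real (test_size n) / real n) \<longlonglongrightarrow> 0"
proof (rule tendsto_sandwich)
  show "\<forall>\<^sub>F n in sequentially. 0 \<le> real (test_size n) / real n" by simp
  show "\<forall>\<^sub>F n in sequentially. real (test_size n) / real n \<le> real n / (ln (real n))\<^sup>2 / real n"
    by (intro always_eventually allI divide_right_mono test_size_bounds) simp
  show "(\<lambda>n. real n / (ln (real n))\<^sup>2 / real n) \<longlonglongrightarrow> 0" by real_asymp
qed simp

lemma half_over_n: "(\<lambda>n. real (n div 2) / real n) \<longlonglongrightarrow> 1 / 2"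
proof (rule tendsto_sandwich)
  show "\<forall>\<^sub>F n in sequentially. (real n / 2 - 1) / real n \<le> real (n div 2) / real n"
  proof (intro always_eventually allI divide_right_mono)
    fix n :: nat
    have "n \<le> 2 * (n div 2) + 1" by presburger
    then have "real n \<le> real (2 * (n div 2) + 1)" by (simp only: of_nat_le_iff)
    then show "real n / 2 - 1 \<le> real (n div 2)" by simp
  qed simp
  show "\<forall>\<^sub>F n in sequentially. real (n div 2) / real n \<le> (real n / 2) / real n"
    by (intro always_eventually allI divide_right_mono) simp_all
  show "(\<lambda>n. (real n / 2 - 1) / real n) \<longlonglongrightarrow> 1 / 2" "(\<lambda>n. real n / 2 / real n) \<longlonglongrightarrow> 1 / 2"
    by real_asymp+
qed

lemma eventually_test_size_le: "\<forall>\<^sub>F n in sequentially. test_size n \<le> n div 2"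
proof -
  have "\<forall>\<^sub>F n in sequentially. real (test_size n) / real n < 1 / 4"
    by (rule order_tendstoD[OF test_size_over_n]) simp
  moreover have "\<forall>\<^sub>F n in sequentially. real (n div 2) / real n > 1 / 4"
    by (rule order_tendstoD[OF half_over_n]) simp
  ultimately show ?thesis using eventually_gt_at_top[of 0]
  proof eventually_elim
    case (elim n)
    then have "real (test_size n) / real n < real (n div 2) / real n" by linarith
    then show ?case using elim by (simp add: divide_less_cancel)
  qed
qed

lemma tendsto_untested_over_n: "(\<lambda>n. real (n div 2 - test_size n) / real n) \<longlonglongrightarrow> 1 / 2"
proof (rule Lim_transform_eventually)
  show "(\<lambda>n. real (n div 2) / real n - real (test_size n) / real n) \<longlonglongrightarrow> 1 / 2"
    using tendsto_diff[OF half_over_n test_size_over_n] by simp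
  show "\<forall>\<^sub>F n in sequentially. real (n div 2) / real n - real (test_size n) / real n =
      real (n div 2 - test_size n) / real n"
    using eventually_test_size_le by eventually_elim (simp add: of_nat_diff diff_divide_distrib)
qed

text \<open>The product is \<open>O(1 / ln n)\<close>: the square in \<open>test_size\<close> beats
  the one logarithm in \<open>edge_prob\<close>.\<close>

lemma test_size_collisions:
  assumes k: "k \<ge> 2"
  shows "(\<lambda>n. real (2 * test_size n * ((n - 2) choose (k - 2))) * edge_prob k n c) \<longlonglongrightarrow> 0"
proof (rule Lim_null_comparison)
  show "\<forall>\<^sub>F n in sequentially. norm (real (2 * test_size n * ((n - 2) choose (k - 2))) * edge_prob k n c) \<le>
      2 * (real n / (ln (real n))\<^sup>2) * ((real k - 1) * \<bar>c\<bar> * ln (real n) / (real n - 1))"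
    using eventually_ge_at_top[of k]
  proof eventually_elim
    case (elim n)
    have n: "n \<ge> 2" using elim k by simp
    have "real (2 * test_size n * ((n - 2) choose (k - 2))) * edge_prob k n c =
        2 * real (test_size n) * ((real k - 1) * c * ln (real n) / (real n - 1))"
      using edge_prob_mult_binomial[OF k elim, of c] by (simp add: mult.assoc)
    also have "norm \<dots> = 2 * real (test_size n) * ((real k - 1) * \<bar>c\<bar> * ln (real n) / (real n - 1))"
      using n k by (simp add: abs_mult abs_divide)
    also have "\<dots> \<le> 2 * (real n / (ln (real n))\<^sup>2) * ((real k - 1) * \<bar>c\<bar> * ln (real n) / (real n - 1))"
      using test_size_bounds(2)[of n] n k by (intro mult_mono mult_nonneg_nonneg divide_nonneg_nonneg) auto
    finally show ?case .
  qed
  show "(\<lambda>n. 2 * (real n / (ln (real n))\<^sup>2) * ((real k - 1) * \<bar>c\<bar> * ln (real n) / (real n - 1))) \<longlonglongrightarrow> 0"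
    by real_asymp
qed

section \<open>The limit along even n\<close>

lemma tendsto_ln_sequentially: "filterlim (\<lambda>n. ln (real n)) at_top sequentially"
  by real_asymp

text \<open>Keeping \<open>P\<close> an arbitrary consequence of \<open>improvable\<close> lets one
  argument serve both estimators.\<close>

lemma improvable_limit:
  assumes k: "k \<ge> 2" and \<beta>: "0 < \<beta>" "\<beta> < \<alpha>" and I2: "I2 k \<alpha> \<beta> < 1"
    and P: "\<And>n \<sigma> H. even n \<Longrightarrow> n > 0 \<Longrightarrow> H \<subseteq> nsets {..<n} k \<Longrightarrow> \<sigma> \<in> balanced_sign_vec n \<Longrightarrow>
      improvable n H \<sigma> \<Longrightarrow> P n \<sigma> H"
  shows "((\<lambda>n. measure_pmf.prob (HSBM n (edge_prob k n \<alpha>) (edge_prob k n \<beta>) k) {(\<sigma>, H). P n \<sigma> H}) \<longlongrightarrow> 1)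
    (inf sequentially (principal {n. even n}))"
proof -
  let ?s = "\<lambda>r. real k - 1 - 2 * real r"
  define \<mu> where "\<mu> = class_rate k \<alpha> \<beta>"
  obtain t where t: "I2 k \<alpha> \<beta> = (\<Sum>r<k. \<mu> r * (1 - exp (- (?s r * t))))"
    "(\<Sum>r<k. ?s r * (\<mu> r * exp (- (?s r * t)))) = 0"
    unfolding \<mu>_def by (rule I2_critical_point[OF k \<beta>])
  define c where "c r = \<mu> r * exp (- (?s r * t))" for r
  have \<mu>: "\<mu> r > 0" if "r < k" for r
    using that \<beta> by (auto simp: \<mu>_def class_rate_def zero_less_binomial_iff)
  have c: "c r > 0" if "r < k" for r using \<mu>[OF that] by (simp add: c_def)
  \<comment> \<open>The counts are \<open>c r * ln n\<close> rounded so that the weighted sum only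
    decreases: down for nonnegative weights, strictly up for negative ones. The bounded shift is
    invisible at scale \<open>ln n\<close>.\<close>
  define m where "m n r = nat \<lfloor>c r * ln (real n)\<rfloor> + (if ?s r < 0 then 2 else 0)" for n r
  have m_bounds: "c r * ln (real n) - 1 \<le> real (m n r)" "real (m n r) \<le> c r * ln (real n) + 2"
    "?s r < 0 \<Longrightarrow> c r * ln (real n) < real (m n r)"
    "\<not> ?s r < 0 \<Longrightarrow> real (m n r) \<le> c r * ln (real n)"
    if "r < k" "n \<ge> 1" for r n
  proof -
    have "0 \<le> c r * ln (real n)" using c[OF that(1)] that(2) by simp
    then show "c r * ln (real n) - 1 \<le> real (m n r)" "real (m n r) \<le> c r * ln (real n) + 2"
      "?s r < 0 \<Longrightarrow> c r * ln (real n) < real (m n r)"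
      "\<not> ?s r < 0 \<Longrightarrow> real (m n r) \<le> c r * ln (real n)"
      unfolding m_def by (cases "?s r < 0"; simp; linarith)+
  qed
  have neg: "(\<Sum>r<k. ?s r * real (m n r)) < 0" if n: "n \<ge> 1" for n
  proof -
    have le: "?s r * real (m n r) \<le> ?s r * (c r * ln (real n))" if "r < k" for r
      using m_bounds(3,4)[OF that n] by (cases "?s r < 0") (auto intro: mult_left_mono mult_left_mono_neg)
    have "(\<Sum>r<k. ?s r * real (m n r)) < (\<Sum>r<k. ?s r * (c r * ln (real n)))"
    proof (rule sum_strict_mono_ex1)
      \<comment> \<open>Type \<open>k - 1\<close> has weight \<open>1 - k < 0\<close>, so its
        rounding is strict. Without rounding the sum is zero by the critical-point equation.\<close>
      show "\<exists>r\<in>{..<k}. ?s r * real (m n r) < ?s r * (c r * ln (real n))"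
      proof (rule bexI)
        have s: "?s (k - 1) < 0" using k by (simp add: of_nat_diff)
        show "?s (k - 1) * real (m n (k - 1)) < ?s (k - 1) * (c (k - 1) * ln (real n))"
          by (rule mult_strict_left_mono_neg[OF m_bounds(3)[OF _ n s] s]) (use k in simp)
      qed (use k in simp)
    qed (use le in auto)
    also have "\<dots> = (\<Sum>r<k. ?s r * c r) * ln (real n)"
      by (simp add: sum_distrib_right mult.assoc)
    also have "\<dots> = 0" using t(2) by (simp add: c_def)
    finally show ?thesis .
  qed
  have m_lim: "(\<lambda>n. real (m n r) / ln (real n)) \<longlonglongrightarrow> c r" if r: "r < k" for r
  proof (rule tendsto_sandwich)
    show "\<forall>\<^sub>F n in sequentially. (c r * ln (real n) - 1) / ln (real n) \<le> real (m n r) / ln (real n)"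
      using eventually_ge_at_top[of 1]
      by eventually_elim (intro divide_right_mono m_bounds r, simp_all)
    show "\<forall>\<^sub>F n in sequentially. real (m n r) / ln (real n) \<le> (c r * ln (real n) + 2) / ln (real n)"
      using eventually_ge_at_top[of 1]
      by eventually_elim (intro divide_right_mono m_bounds r, simp_all)
    show "(\<lambda>n. (c r * ln (real n) - 1) / ln (real n)) \<longlonglongrightarrow> c r"
      "(\<lambda>n. (c r * ln (real n) + 2) / ln (real n)) \<longlonglongrightarrow> c r"
      by real_asymp+
  qed
  define a where "a = test_size"
  define N where "N n r = (n div 2 - a n choose r) * (n div 2 - a n choose (k - 1 - r))" for n r :: nat
  define p where "p n r = edge_prob k n (if r = 0 then \<alpha> else \<beta>)" for n r :: nat
  define \<pi> where "\<pi> n = (\<Prod>r<k. pmf (binomial_pmf (N n r) (p n r)) (m n r))" for n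
  have rate: "(\<lambda>n. real (N n r) * p n r / ln (real n)) \<longlonglongrightarrow> \<mu> r" if r: "r < k" for r
  proof (rule Lim_transform_eventually)
    let ?x = "if r = 0 then \<alpha> else \<beta>"
    have "(\<lambda>n. ?x * (real (N n r) / real ((n - 1) choose (k - 1)))) \<longlonglongrightarrow>
        ?x * (real ((k - 1) choose r) / 2 ^ (k - 1))"
      unfolding N_def a_def
      by (intro tendsto_mult tendsto_const tendsto_binomial_product_ratio tendsto_untested_over_n) (use r in simp)
    then show "(\<lambda>n. ?x * (real (N n r) / real ((n - 1) choose (k - 1)))) \<longlonglongrightarrow> \<mu> r"
      by (simp add: \<mu>_def class_rate_def)
    show "\<forall>\<^sub>F n in sequentially. ?x * (real (N n r) / real ((n - 1) choose (k - 1))) =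
        real (N n r) * p n r / ln (real n)"
      using eventually_gt_at_top[of 1] by eventually_elim (simp add: p_def edge_prob_def)
  qed
  \<comment> \<open>Each of the \<open>k\<close> types may lose \<open>\<epsilon>\<close> in its
    exponent. Together they use half of the gap \<open>1 - I2\<close>, which leaves
    \<open>\<rho>\<close>, the midpoint between \<open>I2\<close> and \<open>1\<close>.\<close>
  define \<epsilon> where "\<epsilon> = (1 - I2 k \<alpha> \<beta>) / (2 * real k)"
  have \<epsilon>: "\<epsilon> > 0" using I2 k by (simp add: \<epsilon>_def)
  define \<rho> where "\<rho> = (1 + I2 k \<alpha> \<beta>) / 2"
  have \<rho>: "\<rho> < 1" using I2 by (simp add: \<rho>_def)
  \<comment> \<open>By the choice of \<open>c\<close>, \<open>ln (\<mu> r / c r)\<close> is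
    \<open>t\<close> times the weight of type \<open>r\<close>, so the logarithmic terms sum to
    \<open>t\<close> times the critical-point equation and vanish. The terms
    \<open>c r - \<mu> r\<close> sum to \<open>- I2\<close>.\<close>
  have exponent: "(\<Sum>r<k. c r * ln (\<mu> r / c r) + c r - \<mu> r - \<epsilon>) = - \<rho>"
  proof -
    have "(\<Sum>r<k. c r * ln (\<mu> r / c r) + c r - \<mu> r - \<epsilon>) =
        (\<Sum>r<k. t * (?s r * c r) - \<mu> r * (1 - exp (- (?s r * t))) - \<epsilon>)"
    proof (rule sum.cong[OF refl])
      fix r assume "r \<in> {..<k}"
      then have "\<mu> r / c r = 1 / exp (- (?s r * t))"
        using \<mu>[of r] by (simp add: c_def)
      also have "\<dots> = exp (?s r * t)"
        by (simp only: exp_minus inverse_eq_divide) simp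
      finally have "ln (\<mu> r / c r) = ?s r * t" by simp
      then show "c r * ln (\<mu> r / c r) + c r - \<mu> r - \<epsilon> = t * (?s r * c r) - \<mu> r * (1 - exp (- (?s r * t))) - \<epsilon>"
        by (simp add: c_def right_diff_distrib)
    qed
    also have "\<dots> = t * (\<Sum>r<k. ?s r * c r) - I2 k \<alpha> \<beta> - real k * \<epsilon>"
      by (simp add: sum_subtractf sum_distrib_left t(1))
    also have "(\<Sum>r<k. ?s r * c r) = 0" using t(2) by (simp add: c_def)
    also have "real k * \<epsilon> = (1 - I2 k \<alpha> \<beta>) / 2" using k by (simp add: \<epsilon>_def)
    finally show ?thesis by (simp add: \<rho>_def field_simps)
  qed
  have "\<forall>\<^sub>F n in sequentially. \<forall>r\<in>{..<k}. pmf (binomial_pmf (N n r) (p n r)) (m n r) \<ge>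
      exp (ln (real n) * (c r * ln (\<mu> r / c r) + c r - \<mu> r - \<epsilon>))"
  proof (rule eventually_ball_finite, simp, intro ballI)
    fix r assume "r \<in> {..<k}"
    then have r: "r < k" by simp
    show "\<forall>\<^sub>F n in sequentially. pmf (binomial_pmf (N n r) (p n r)) (m n r) \<ge>
      exp (ln (real n) * (c r * ln (\<mu> r / c r) + c r - \<mu> r - \<epsilon>))"
      using tendsto_ln_sequentially _ rate[OF r] m_lim[OF r] \<mu>[OF r] c[OF r] \<epsilon>
    proof (rule eventually_pmf_binomial_ge)
      show "filterlim (\<lambda>n. p n r) (at_right 0) sequentially"
        unfolding p_def using \<beta> by (intro filterlim_edge_prob k) auto
    qed
  qed
  \<comment> \<open>A single test succeeds with probability at least
    \<open>n powr (- \<rho>)\<close>.\<close>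
  then have \<pi>_ge: "\<forall>\<^sub>F n in sequentially. \<pi> n \<ge> exp (- (\<rho> * ln (real n)))"
  proof eventually_elim
    case (elim n)
    have "exp (- (\<rho> * ln (real n))) = exp (\<Sum>r<k. ln (real n) * (c r * ln (\<mu> r / c r) + c r - \<mu> r - \<epsilon>))"
      by (simp only: sum_distrib_left[symmetric] exponent) (simp add: mult.commute)
    also have "\<dots> = (\<Prod>r<k. exp (ln (real n) * (c r * ln (\<mu> r / c r) + c r - \<mu> r - \<epsilon>)))"
      by (rule exp_sum) simp
    also have "\<dots> \<le> \<pi> n"
      unfolding \<pi>_def by (rule prod_mono) (use elim in auto)
    finally show ?case .
  qed
  have \<pi>01: "0 \<le> \<pi> n" "\<pi> n \<le> 1" for n
    unfolding \<pi>_def by (auto intro!: prod_nonneg prod_le_1 simp: pmf_le_1)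
  \<comment> \<open>Here \<open>(1 - \<pi>) ^ a \<le> exp (- a * \<pi>)\<close>, and
    \<open>a * \<pi>\<close> is at least of order \<open>n powr (1 - \<rho>) / (ln n)^2\<close>,
    which diverges as \<open>\<rho> < 1\<close>.\<close>
  have "(\<lambda>n. (1 - \<pi> n) ^ a n) \<longlonglongrightarrow> 0"
  proof (rule Lim_null_comparison)
    show "\<forall>\<^sub>F n in sequentially. norm ((1 - \<pi> n) ^ a n) \<le>
        exp (- ((real n / (ln (real n))\<^sup>2 - 1) * exp (- (\<rho> * ln (real n)))))"
      using \<pi>_ge
    proof eventually_elim
      case (elim n)
      have "norm ((1 - \<pi> n) ^ a n) = (1 - \<pi> n) ^ a n" using \<pi>01[of n] by simp
      also have "\<dots> \<le> exp (- \<pi> n) ^ a n"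
        using \<pi>01[of n] exp_ge_add_one_self[of "- \<pi> n"] by (intro power_mono) auto
      also have "\<dots> = exp (- (real (a n) * \<pi> n))" by (simp flip: exp_of_nat_mult)
      finally have 1: "norm ((1 - \<pi> n) ^ a n) \<le> exp (- (real (a n) * \<pi> n))" .
      have "(real n / (ln (real n))\<^sup>2 - 1) * exp (- (\<rho> * ln (real n))) \<le> real (a n) * exp (- (\<rho> * ln (real n)))"
        unfolding a_def by (intro mult_right_mono test_size_bounds) simp
      also have "\<dots> \<le> real (a n) * \<pi> n"
        using elim by (rule mult_left_mono) simp
      finally have "(real n / (ln (real n))\<^sup>2 - 1) * exp (- (\<rho> * ln (real n))) \<le> real (a n) * \<pi> n" .
      then have "exp (- (real (a n) * \<pi> n)) \<le> exp (- ((real n / (ln (real n))\<^sup>2 - 1) * exp (- (\<rho> * ln (real n)))))"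
        by simp
      with 1 show ?case by (rule order.trans)
    qed
    show "(\<lambda>n. exp (- ((real n / (ln (real n))\<^sup>2 - 1) * exp (- (\<rho> * ln (real n)))))) \<longlonglongrightarrow> 0"
      using \<rho> by real_asymp
  qed
  define \<delta> where "\<delta> n = 2 * ((1 - \<pi> n) ^ a n + real (2 * a n * ((n - 2) choose (k - 2))) * edge_prob k n \<alpha>)" for n
  have "\<delta> \<longlonglongrightarrow> 2 * (0 + 0)"
    unfolding \<delta>_def using \<open>(\<lambda>n. (1 - \<pi> n) ^ a n) \<longlonglongrightarrow> 0\<close> test_size_collisions[OF k]
    by (intro tendsto_mult tendsto_add tendsto_const) (simp_all add: a_def)
  then have "(\<lambda>n. 1 - \<delta> n) \<longlonglongrightarrow> 1"
    using tendsto_diff[OF tendsto_const[of 1], of \<delta> 0] by simp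
  then have \<delta>_lim: "((\<lambda>n. 1 - \<delta> n) \<longlongrightarrow> 1) (inf sequentially (principal {n. even n}))"
    by (rule tendsto_mono[rotated]) simp
  have small: "\<forall>\<^sub>F n in sequentially. edge_prob k n \<alpha> < 1"
    using filterlim_edge_prob[OF k, of \<alpha>] \<beta> by (intro order_tendstoD) (auto simp: filterlim_at)
  have "\<forall>\<^sub>F n in sequentially. even n \<longrightarrow> 1 - \<delta> n \<le>
      measure_pmf.prob (HSBM n (edge_prob k n \<alpha>) (edge_prob k n \<beta>) k) {(\<sigma>, H). P n \<sigma> H}"
    using small eventually_test_size_le eventually_ge_at_top[of 1]
  proof eventually_elim
    case (elim n)
    show ?case
    proof (intro impI prob_HSBM_ge)
      fix \<sigma> assume n: "even n" and \<sigma>: "\<sigma> \<in> balanced_sign_vec n"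
      let ?M = "Pi_pmf (nsets {..<n} k) False
          (\<lambda>e. bernoulli_pmf (if \<forall>i\<in>e. \<forall>j\<in>e. \<sigma> $ i = \<sigma> $ j then edge_prob k n \<alpha> else edge_prob k n \<beta>))"
      have "measure_pmf.prob ?M {f. \<not> P n \<sigma> {e \<in> nsets {..<n} k. f e}} \<le>
          measure_pmf.prob ?M {f. \<not> improvable n {e \<in> nsets {..<n} k. f e} \<sigma>}"
        using P[OF n _ _ \<sigma>] elim by (intro measure_pmf.finite_measure_mono) auto
      also have "\<dots> \<le> \<delta> n"
      proof -
        have "0 \<le> edge_prob k n \<beta>" "edge_prob k n \<beta> \<le> edge_prob k n \<alpha>"
          using \<beta> elim unfolding edge_prob_def by (auto intro!: divide_right_mono mult_right_mono)
        moreover have "\<pi> n = (\<Prod>r<k. pmf (binomial_pmf ((n div 2 - a n choose r) * (n div 2 - a n choose (k - 1 - r)))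
            (if r = 0 then edge_prob k n \<alpha> else edge_prob k n \<beta>)) (m n r))"
          unfolding \<pi>_def N_def p_def by (rule prod.cong) auto
        ultimately show ?thesis
          unfolding \<delta>_def
          using prob_not_improvable_le[OF k n \<sigma>, of "a n" "edge_prob k n \<beta>" "edge_prob k n \<alpha>" "m n"]
            neg[of n] elim by (simp add: a_def)
      qed
      finally show "measure_pmf.prob ?M {f. \<not> P n \<sigma> {e \<in> nsets {..<n} k. f e}} \<le> \<delta> n" .
    qed
  qed
  then have "\<forall>\<^sub>F n in inf sequentially (principal {n. even n}). 1 - \<delta> n \<le>
      measure_pmf.prob (HSBM n (edge_prob k n \<alpha>) (edge_prob k n \<beta>) k) {(\<sigma>, H). P n \<sigma> H}"
    by (simp add: eventually_inf_principal)
  then show ?thesis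
    by (rule tendsto_sandwich[OF _ _ \<delta>_lim tendsto_const]) (simp add: always_eventually)
qed

theorem theorem8:
  fixes k :: nat and \<alpha> \<beta> :: real
  assumes "k \<ge> 2"
    and "\<beta> > 0"
    and "\<alpha> > \<beta>"
    and "I2 k \<alpha> \<beta> < 1"
  shows "(\<forall>est. trunc_estimator k est \<longrightarrow>
           ((\<lambda>n. measure_pmf.prob (HSBM n (edge_prob k n \<alpha>) (edge_prob k n \<beta>) k)
               {(\<sigma>, H). est n H \<notin> {- \<sigma>, \<sigma>}}) \<longlongrightarrow> 1)
             (inf sequentially (principal {n. even n}))) \<and>
         (\<forall>est. relax_estimator k est \<longrightarrow>
           ((\<lambda>n. measure_pmf.prob (HSBM n (edge_prob k n \<alpha>) (edge_prob k n \<beta>) k)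
               {(\<sigma>, H). est n H \<noteq> outer_prod \<sigma> \<sigma>}) \<longlongrightarrow> 1)
             (inf sequentially (principal {n. even n})))"
proof (intro conjI allI impI)
  fix est assume est: "trunc_estimator k est"
  show "((\<lambda>n. measure_pmf.prob (HSBM n (edge_prob k n \<alpha>) (edge_prob k n \<beta>) k)
      {(\<sigma>, H). est n H \<notin> {- \<sigma>, \<sigma>}}) \<longlongrightarrow> 1) (inf sequentially (principal {n. even n}))"
  proof (rule improvable_limit[OF assms])
    fix n \<sigma> H
    assume *: "even n" "n > 0" "H \<subseteq> nsets {..<n} k" "\<sigma> \<in> balanced_sign_vec n" "improvable n H \<sigma>"
    have "is_sigma_trunc n H (est n H)" using est * by (simp add: trunc_estimator_def)
    then show "est n H \<notin> {- \<sigma>, \<sigma>}" using not_optimal(1,2)[OF *(3-5)] by auto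
  qed
next
  fix est assume est: "relax_estimator k est"
  show "((\<lambda>n. measure_pmf.prob (HSBM n (edge_prob k n \<alpha>) (edge_prob k n \<beta>) k)
      {(\<sigma>, H). est n H \<noteq> outer_prod \<sigma> \<sigma>}) \<longlongrightarrow> 1) (inf sequentially (principal {n. even n}))"
  proof (rule improvable_limit[OF assms])
    fix n \<sigma> H
    assume *: "even n" "n > 0" "H \<subseteq> nsets {..<n} k" "\<sigma> \<in> balanced_sign_vec n" "improvable n H \<sigma>"
    have "is_Sigma_relax n H (est n H)" using est * by (simp add: relax_estimator_def)
    then show "est n H \<noteq> outer_prod \<sigma> \<sigma>" using not_optimal(3)[OF *(3-5)] by auto
  qed
qed

end
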